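(* For each $m\ge1$, let the data $(X_m,Y_m)$ follow the linear regression model $Y_m=X_m\beta_m+\varepsilon_m$, where $Y_m$ is an $n_m$-dimensional vector of outcomes, $X_m$ is a (non-random) $n_m\times p_m$ matrix, $\beta_m$ is an unknown $p_m$-dimensional parameter vector, and $\varepsilon_m$ is a random vector with independent entries $\varepsilon_{m,i}$, $i=1,\dots,n_m$, such that $\varepsilon_{m,i}=_d-\varepsilon_{m,i}$. Let $P_{X_m}$ be the orthogonal projection onto the row space of $X_m$ and $\Theta_{m1}\subset\mathbb R^{p_m}$. Consider the randomization tests of the null hypotheses $P_{X_m}\beta_m=0$ with test statistics $\|\hat\beta_m\|_\infty$, where $\hat\beta_m=X_m^\dagger Y_m$, and randomization distributions uniform over the $n_m\times n_m$ diagonal matrices with independent Rademacher diagonal entries (acting on $Y_m$ by multiplication). Suppose there are two sequences $(l_m)_{m\ge1}$ and $(t_m)_{m\ge1}$ such that: 1. $l_m>0$ for all $m$ and $l_m\to\infty$ as $m\to\infty$; 2. $t_m>0$ for all $m$ and $P\big(U^+(\mathcal X_m(|\varepsilon_m|),l_m)\le t_m\big)\to1$; 3. for every sequence $(P_{X_m}\beta_m)_{m\ge1}$ such that $P_{X_m}\beta_m\in\Theta_{m1}$ for all $m\ge 1$, $$\liminf_{m\to\infty}\left(\|P_{X_m}\beta_m\|_\infty\,\frac{1-U^+(T(X_m),l_m)}{2t_m}\right)>1.$$ Then the sequence of randomization tests is consistent against the sequence of alternatives with $P_{X_m}\beta_m\in\Theta_{m1}$.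
   Context: $X_m^\dagger$ is the Moore-Penrose pseudo-inverse of $X_m$ and $[X_m^\dagger]_{j,\cdot}$ its $j$-th row. $\mathrm{diag}(v)$ is the diagonal matrix with diagonal $v$. For a set $T\subset\mathbb R^q$: $b(T)=\mathbb E\sup_{t\in T}t^\top b$, where $b\in\mathbb R^q$ has iid Rademacher (uniform on $\{\pm1\}$) entries; $r(T)$ is the infimum of the radii of all Euclidean balls (with arbitrary centers) containing $T$; and for a scalar $l$, $U^+(T,l)=b(T)+l\cdot r(T)$. For a matrix in place of $T$, the set is the set of its rows. For $v\in\mathbb R^{n_m}$, $\mathcal X_m(v)=[X_m^\dagger\mathrm{diag}(v);\,-X_m^\dagger\mathrm{diag}(v)]$ is the $2p_m\times n_m$ matrix obtained by stacking vertically. $|\varepsilon_m|=(|\varepsilon_{m,1}|,\dots,|\varepsilon_{m,n_m}|)^\top$. Also $$T(X_m)=\{\mathrm{diag}([X_m^\dagger]_{j,\cdot})X_mw:\ w\in\mathbb R^{p_m},\ \|w\|_\infty\le1,\ j\in\{1,\dots,p_m\}\}\subset\mathbb R^{n_m}.$$ Randomization test: with $f_m(Y)=\|X_m^\dagger Y\|_\infty$, a fixed level $\alpha\in(0,1]$ and a fixed integer $K\ge1$ with $1/(K+1)\le\alpha$, draw $G_{m1},\dots,G_{mK}$ iid uniform over the group of $n_m\times n_m$ diagonal matrices with $\pm1$ diagonal entries, independently of the data; let $f_{(1)}\le\dots\le f_{(K+1)}$ be the ordered values of $f_m(Y_m),f_m(G_{m1}Y_m),\dots,f_m(G_{mK}Y_m)$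 and $k=\lceil(1-\alpha)(K+1)\rceil$; reject when $f_m(Y_m)>f_{(k)}$ (with $f_{(0)}=-\infty$). Consistent means: for every sequence $(\beta_m)_{m\ge1}$ with $P_{X_m}\beta_m\in\Theta_{m1}$ for all $m$, the rejection probability (over the noise and the random group elements) tends to $1$ as $m\to\infty$. *)

theory Defs
  imports "HOL-Probability.Probability" "Jordan_Normal_Form.VS_Connect"
begin

unbundle no vec_syntax
no_notation inner (infix "\<bullet>" 70)

definition eucl_norm :: "real vec \<Rightarrow> real" where
  "eucl_norm v = sqrt (v \<bullet> v)"

text \<open>The inserted 0 only fixes the value for the zero-dimensional vector.\<close>

definition sup_norm :: "real vec \<Rightarrow> real" where
  "sup_norm v = Max (insert 0 ((\<lambda>i. \<bar>v $ i\<bar>) ` {..<dim_vec v}))"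

definition diag :: "real vec \<Rightarrow> real mat" where
  "diag v = mat_diag (dim_vec v) (\<lambda>i. v $ i)"

text \<open>The Moore-Penrose pseudo-inverse, as the unique solution of the four Penrose equations.\<close>

definition is_pinv :: "real mat \<Rightarrow> real mat \<Rightarrow> bool" where
  "is_pinv A B \<longleftrightarrow> B \<in> carrier_mat (dim_col A) (dim_row A) \<and>
     A * B * A = A \<and> B * A * B = B \<and>
     transpose_mat (A * B) = A * B \<and> transpose_mat (B * A) = B * A"

definition pinv :: "real mat \<Rightarrow> real mat" where
  "pinv A = (THE B. is_pinv A B)"

text \<open>Orthogonal projection of \<open>v\<close> onto the row space of \<open>A\<close>, for \<open>v\<close> of dimension \<open>dim_col A\<close>.\<close>

definition proj_row_space :: "real mat \<Rightarrow> real vec \<Rightarrow> real vec" where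
  "proj_row_space A v = (THE u. u \<in> vec_space.row_space (dim_col A) A \<and>
     (\<forall>w \<in> vec_space.row_space (dim_col A) A. (v - u) \<bullet> w = 0))"

text \<open>Law of a \<open>q\<close>-dimensional vector with iid Rademacher entries; the \<open>0\<close> is the
  irrelevant default value of \<open>Pi_pmf\<close> outside \<open>{..<q}\<close>.\<close>

definition rademacher_vec :: "nat \<Rightarrow> real vec pmf" where
  "rademacher_vec q = map_pmf (Matrix.vec q) (Pi_pmf {..<q} 0 (\<lambda>_. pmf_of_set {-1, 1}))"

text \<open>In the following \<open>q\<close> is the dimension of the ambient space, \<open>T \<subseteq> carrier_vec q\<close>.\<close>

definition rademacher_width :: "nat \<Rightarrow> real vec set \<Rightarrow> real" where
  "rademacher_width q T = measure_pmf.expectation (rademacher_vec q) (\<lambda>b. SUP t\<in>T. t \<bullet> b)"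

definition set_radius :: "nat \<Rightarrow> real vec set \<Rightarrow> real" where
  "set_radius q T = Inf {\<rho>. \<rho> \<ge> 0 \<and> (\<exists>c \<in> carrier_vec q. \<forall>t\<in>T. eucl_norm (t - c) \<le> \<rho>)}"

definition U_plus :: "nat \<Rightarrow> real vec set \<Rightarrow> real \<Rightarrow> real" where
  "U_plus q T l = rademacher_width q T + l * set_radius q T"

definition noise_mat :: "real mat \<Rightarrow> real vec \<Rightarrow> real mat" where
  "noise_mat X v = (pinv X * diag v) @\<^sub>r (- (pinv X * diag v))"

definition signal_set :: "real mat \<Rightarrow> real vec set" where
  "signal_set X = {(diag (Matrix.row (pinv X) j) * X) *\<^sub>v w | w j.
     w \<in> carrier_vec (dim_col X) \<and> sup_norm w \<le> 1 \<and> j < dim_col X}"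

definition sign_group :: "nat \<Rightarrow> real mat set" where
  "sign_group n = {diag s | s. s \<in> carrier_vec n \<and> (\<forall>i<n. s $ i \<in> {-1, 1})}"

definition test_stat :: "real mat \<Rightarrow> real vec \<Rightarrow> real" where
  "test_stat X y = sup_norm (pinv X *\<^sub>v y)"

definition ordered_values ::
    "(real vec \<Rightarrow> real) \<Rightarrow> nat \<Rightarrow> (nat \<Rightarrow> real mat) \<Rightarrow> real vec \<Rightarrow> real list" where
  "ordered_values f K G y = sort (f y # map (\<lambda>k. f (G k *\<^sub>v y)) [1..<K+1])"

text \<open>The \<open>k\<close>-th smallest of the \<open>K + 1\<close> values (1-based), with value \<open>-\<infinity>\<close> at \<open>k = 0\<close>.\<close>

definition order_statistic ::
    "(real vec \<Rightarrow> real) \<Rightarrow> nat \<Rightarrow> (nat \<Rightarrow> real mat) \<Rightarrow> real vec \<Rightarrow> nat \<Rightarrow> ereal" where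
  "order_statistic f K G y k =
     (if k = 0 then -\<infinity> else ereal (ordered_values f K G y ! (k - 1)))"

definition rejects ::
    "(real vec \<Rightarrow> real) \<Rightarrow> real \<Rightarrow> nat \<Rightarrow> (nat \<Rightarrow> real mat) \<Rightarrow> real vec \<Rightarrow> bool" where
  "rejects f \<alpha> K G y \<longleftrightarrow>
     ereal (f y) > order_statistic f K G y (nat \<lceil>(1 - \<alpha>) * (real K + 1)\<rceil>)"

text \<open>The product measure realizes \<open>G 1, \<dots>, G K\<close> as iid uniform on the sign group and
  independent of the data \<open>Y\<close>, which is a random vector on \<open>M\<close>.\<close>

definition group_draws :: "nat \<Rightarrow> nat \<Rightarrow> (nat \<Rightarrow> real mat) measure" where
  "group_draws n K = (\<Pi>\<^sub>M k\<in>{1..K}. uniform_count_measure (sign_group n))"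

definition rejection_prob ::
    "'a measure \<Rightarrow> real mat \<Rightarrow> real \<Rightarrow> nat \<Rightarrow> ('a \<Rightarrow> real vec) \<Rightarrow> real" where
  "rejection_prob M X \<alpha> K Y =
     measure (M \<Otimes>\<^sub>M group_draws (dim_row X) K)
       {(\<omega>, G) \<in> space (M \<Otimes>\<^sub>M group_draws (dim_row X) K). rejects (test_stat X) \<alpha> K G (Y \<omega>)}"

text \<open>Sequences are indexed by \<open>m \<ge> 1\<close>; the entries at \<open>m = 0\<close> are unconstrained and irrelevant.
  The noise \<open>\<epsilon> m\<close> lives on its own probability space \<open>M m\<close>.\<close>

definition alternative_seq ::
    "(nat \<Rightarrow> real mat) \<Rightarrow> (nat \<Rightarrow> real vec set) \<Rightarrow> (nat \<Rightarrow> real vec) \<Rightarrow> bool" where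
  "alternative_seq X \<Theta> \<beta> \<longleftrightarrow>
     (\<forall>m\<ge>1. \<beta> m \<in> carrier_vec (dim_col (X m)) \<and> proj_row_space (X m) (\<beta> m) \<in> \<Theta> m)"

definition consistent_tests ::
    "(nat \<Rightarrow> 'a measure) \<Rightarrow> (nat \<Rightarrow> 'a \<Rightarrow> real vec) \<Rightarrow> (nat \<Rightarrow> real mat) \<Rightarrow>
     (nat \<Rightarrow> real vec set) \<Rightarrow> real \<Rightarrow> nat \<Rightarrow> bool" where
  "consistent_tests M \<epsilon> X \<Theta> \<alpha> K \<longleftrightarrow>
     (\<forall>\<beta>. alternative_seq X \<Theta> \<beta> \<longrightarrow>
        (\<lambda>m. rejection_prob (M m) (X m) \<alpha> K (\<lambda>\<omega>. X m *\<^sub>v \<beta> m + \<epsilon> m \<omega>)) \<longlonglongrightarrow> 1)"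

end

theory Submission
  imports Defs
begin

text \<open>The noise in the observed statistic carries no random sign. Its law is however invariant
  under every fixed sign change, so the probability that it is large equals the mean over all sign
  vectors of the probability for the randomized noise. This finite average takes the place of
  conditioning on the absolute values, and one estimate serves all \<open>K + 1\<close> noise terms.
  A variance bound is strong enough because \<open>K\<close> stays fixed while \<open>l\<close>
  tends to infinity, so that the union bound costs only a constant factor. Closure of the sets under
  negation is used twice: it turns sup-norms into suprema of linear forms, and it makes balls with
  arbitrary centers no better than balls about the origin. The signal set is infinite, so its
  supremum is handled through near-maximizers.\<close>

text \<open>Write \<open>B\<close> for the pseudo-inverse of \<open>X\<close> and \<open>u = B X \<beta>\<close> for the projected parameter. The observed
  statistic is at least \<open>\<parallel>u\<parallel> - \<parallel>B \<epsilon>\<parallel>\<close>, while a randomized one is at most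
  \<open>\<parallel>B G X u\<parallel> + \<parallel>B G \<epsilon>\<parallel>\<close>. Given \<open>\<bar>\<epsilon>\<bar>\<close>, all these norms other than \<open>\<parallel>u\<parallel>\<close> are suprema of
  Rademacher processes over symmetric sets \<open>T\<close>; the discrete Poincare inequality
  bounds their variance by \<open>2 r(T)\<^sup>2\<close>, so each exceeds \<open>U\<^sup>+(T, l)\<close> with probability at most \<open>2 / l\<^sup>2\<close>.
  Hence with probability tending to 1 the observed statistic exceeds all \<open>K\<close> randomized ones as soon
  as \<open>\<parallel>u\<parallel> - t > \<parallel>u\<parallel> U\<^sup>+(T(X), l) + t\<close>, which is the signal condition.\<close>

section \<open>The Moore-Penrose inverse\<close>

text \<open>Least squares by induction on the columns, a form of Gram-Schmidt. With \<open>z\<close>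
  the coefficients of the projection of column \<open>k\<close> onto the earlier ones, moving
  \<open>x\<close> along \<open>z - unit_vec p k\<close> changes the residual by a multiple of
  \<open>u\<close>, which is orthogonal to the earlier columns. Only orthogonality to column
  \<open>k\<close> has to be restored. The vanishing coordinates keep \<open>X z\<close> in the span
  of the first \<open>k\<close> columns.\<close>

lemma normal_equations_initial_columns:
  fixes X :: "real mat"
  assumes X: "X \<in> carrier_mat n p" and k: "k \<le> p" and y: "y \<in> carrier_vec n"
  shows "\<exists>x\<in>carrier_vec p. (\<forall>i<p. k \<le> i \<longrightarrow> x $ i = 0) \<and> (\<forall>j<k. col X j \<bullet> (X *\<^sub>v x - y) = 0)"
  using k y
proof (induction k arbitrary: y)
  case 0
  show ?case by (rule bexI[of _ "0\<^sub>v p"]) auto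
next
  case (Suc k)
  have e: "unit_vec p k \<in> carrier_vec p" and colk: "X *\<^sub>v unit_vec p k = col X k"
    and ck: "col X k \<in> carrier_vec n"
    using X Suc.prems by (auto intro!: eq_vecI)
  obtain z where z: "z \<in> carrier_vec p" "\<forall>i<p. k \<le> i \<longrightarrow> z $ i = 0"
      "\<forall>j<k. col X j \<bullet> (X *\<^sub>v z - col X k) = 0"
    using Suc.IH[OF _ ck] Suc.prems by auto
  obtain x where x: "x \<in> carrier_vec p" "\<forall>i<p. k \<le> i \<longrightarrow> x $ i = 0"
      "\<forall>j<k. col X j \<bullet> (X *\<^sub>v x - y) = 0"
    using Suc.IH[of y] Suc.prems by auto
  define u where "u = X *\<^sub>v z - col X k"
  define r where "r = X *\<^sub>v x - y"
  \<comment> \<open>The coefficient that makes the new residual orthogonal to \<open>u\<close>. If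
    column \<open>k\<close> lies in the span of the earlier ones, then \<open>u = 0\<close> and
    division by zero gives \<open>c = 0\<close>, which is harmless.\<close>
  define c where "c = - (u \<bullet> r) / (u \<bullet> u)"
  define x' where "x' = x + c \<cdot>\<^sub>v (z - unit_vec p k)"
  have u: "u \<in> carrier_vec n" and r: "r \<in> carrier_vec n"
    using X z x ck Suc.prems by (auto simp: u_def r_def)
  have x': "x' \<in> carrier_vec p" using x z by (auto simp: x'_def)
  have res: "X *\<^sub>v x' - y = r + c \<cdot>\<^sub>v u"
    using X x z e ck Suc.prems colk
    by (intro eq_vecI)
       (auto simp: x'_def r_def u_def mult_add_distrib_mat_vec[of _ n p] mult_mat_vec[of _ n p] mult_minus_distrib_mat_vec[of _ n p])
  have orth: "col X j \<bullet> (r + c \<cdot>\<^sub>v u) = 0" if "j < k" for j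
  proof -
    have "col X j \<in> carrier_vec n" using X that Suc.prems by auto
    then show ?thesis using that x z u r
      by (simp add: scalar_prod_add_distrib[of _ n] flip: u_def r_def)
  qed
  have "(X *\<^sub>v z) \<bullet> (r + c \<cdot>\<^sub>v u) = z \<bullet> (transpose_mat X *\<^sub>v (r + c \<cdot>\<^sub>v u))"
    using transpose_vec_mult_scalar[of X n p z "r + c \<cdot>\<^sub>v u"] X z u r
    by (simp add: comm_scalar_prod[of _ n] comm_scalar_prod[of _ p])
  also have "\<dots> = (\<Sum>i = 0..<p. z $ i * (col X i \<bullet> (r + c \<cdot>\<^sub>v u)))"
    using X z u r by (subst scalar_prod_def) (auto intro!: sum.cong)
  also have "\<dots> = 0"
    using z(2) orth by (intro sum.neutral) (metis atLeastLessThan_iff linorder_not_less mult_zero_left mult_zero_right)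
  finally have Xz: "(X *\<^sub>v z) \<bullet> (r + c \<cdot>\<^sub>v u) = 0" .
  have "u \<bullet> u = 0 \<Longrightarrow> u \<bullet> r = 0"
    using u r by (simp add: scalar_prod_def sum_nonneg_eq_0_iff)
  then have "u \<bullet> (r + c \<cdot>\<^sub>v u) = 0"
    using u r by (simp add: scalar_prod_add_distrib[of _ n] c_def)
  moreover have "col X k = X *\<^sub>v z - u"
    using X z ck by (intro eq_vecI) (auto simp: u_def)
  ultimately have "col X k \<bullet> (r + c \<cdot>\<^sub>v u) = 0"
    using Xz X z u r by (simp add: minus_scalar_prod_distrib[of _ n])
  then have "\<forall>j<Suc k. col X j \<bullet> (X *\<^sub>v x' - y) = 0"
    using orth unfolding res by (auto simp: less_Suc_eq)
  moreover have "\<forall>i<p. Suc k \<le> i \<longrightarrow> x' $ i = 0"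
    using x z by (auto simp: x'_def)
  ultimately show ?case using x' by blast
qed

lemma normal_equations_solvable:
  fixes X :: "real mat"
  assumes X: "X \<in> carrier_mat n p" and y: "y \<in> carrier_vec n"
  obtains x where "x \<in> carrier_vec p" "transpose_mat X *\<^sub>v (X *\<^sub>v x) = transpose_mat X *\<^sub>v y"
proof -
  obtain x where x: "x \<in> carrier_vec p" and o: "\<forall>j<p. col X j \<bullet> (X *\<^sub>v x - y) = 0"
    using normal_equations_initial_columns[OF X le_refl y] by auto
  have "transpose_mat X *\<^sub>v (X *\<^sub>v x) = transpose_mat X *\<^sub>v y"
  proof (rule eq_vecI)
    fix j assume "j < dim_vec (transpose_mat X *\<^sub>v y)"
    then have j: "j < p" using X by simp
    then have "col X j \<in> carrier_vec n" using X by auto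
    then have "col X j \<bullet> (X *\<^sub>v x) - col X j \<bullet> y = 0"
      using o j X x y by (simp add: scalar_prod_minus_distrib[of _ n])
    then show "(transpose_mat X *\<^sub>v (X *\<^sub>v x)) $ j = (transpose_mat X *\<^sub>v y) $ j"
      using j X by simp
  qed simp
  with x show ?thesis by (rule that)
qed

text \<open>Column \<open>i\<close> of \<open>B\<close> solves the least squares problem for
  \<open>unit_vec n i\<close>, so the normal equations read \<open>X^T X B = X^T\<close>.
  Transposing gives \<open>(X B)^T X = X\<close>; multiplying this by \<open>B\<close> shows that
  \<open>X B\<close> equals the symmetric matrix \<open>(X B)^T (X B)\<close>.\<close>

lemma left_symmetric_inverse_exists:
  fixes X :: "real mat"
  assumes X: "X \<in> carrier_mat n p"
  obtains B where "B \<in> carrier_mat p n" "X * B * X = X" "transpose_mat (X * B) = X * B"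
proof -
  have "\<exists>x\<in>carrier_vec p. transpose_mat X *\<^sub>v (X *\<^sub>v x) = transpose_mat X *\<^sub>v unit_vec n i" for i
    using normal_equations_solvable[OF X, of "unit_vec n i"] by auto
  then obtain x where x: "\<And>i. x i \<in> carrier_vec p"
      "\<And>i. transpose_mat X *\<^sub>v (X *\<^sub>v x i) = transpose_mat X *\<^sub>v unit_vec n i"
    by metis
  define B where "B = mat_of_cols p (map x [0..<n])"
  have B: "B \<in> carrier_mat p n" by (auto simp: B_def mat_of_cols_def)
  have colB: "col B i = x i" if "i < n" for i
    using that x(1) by (simp add: B_def)
  have Xt: "transpose_mat X \<in> carrier_mat p n" using X by simp
  have N: "transpose_mat X * (X * B) = transpose_mat X"
  proof (rule mat_col_eqI)
    fix i assume "i < dim_col (transpose_mat X)"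
    then have i: "i < n" using X by simp
    have "col (transpose_mat X * (X * B)) i = transpose_mat X *\<^sub>v (X *\<^sub>v x i)"
      using X B i by (simp add: col_mult2[OF Xt _ i] col_mult2[OF X B i] colB del: col_mult2)
    also have "\<dots> = col (transpose_mat X) i"
      unfolding x(2) using X i by (intro eq_vecI) auto
    finally show "col (transpose_mat X * (X * B)) i = col (transpose_mat X) i" .
  qed (use X B in auto)
  have XB: "X * B \<in> carrier_mat n n" using X B by simp
  have "transpose_mat (transpose_mat X * (X * B)) = transpose_mat (X * B) * X"
    using transpose_mult[OF Xt XB] by simp
  then have T: "transpose_mat (X * B) * X = X" by (simp add: N)
  have "transpose_mat (X * B) * (X * B) = transpose_mat (X * B) * X * B"
    using XB X B by (subst assoc_mult_mat[of _ n n _ p _ n]) auto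
  then have E: "transpose_mat (X * B) * (X * B) = X * B" using T by simp
  then have S: "transpose_mat (X * B) = X * B"
    using transpose_mult[of "transpose_mat (X * B)" n n "X * B" n] XB by simp
  show ?thesis using that[OF B] T S by simp
qed

text \<open>The previous lemma, applied to \<open>A\<close> and to its transpose, gives generalized
  inverses \<open>B\<close> and \<open>C\<close> with \<open>A B\<close> and \<open>C A\<close>
  symmetric. The product \<open>C A B\<close> inherits both symmetries, since
  \<open>A (C A B) = A B\<close> and \<open>(C A B) A = C A\<close>.\<close>

lemma is_pinv_exists: "\<exists>B. is_pinv A B"
proof -
  define n p where "n = dim_row A" and "p = dim_col A"
  have A: "A \<in> carrier_mat n p" by (simp add: n_def p_def)
  obtain B where B: "B \<in> carrier_mat p n" "A * B * A = A" "transpose_mat (A * B) = A * B"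
    by (rule left_symmetric_inverse_exists[OF A])
  obtain D where D: "D \<in> carrier_mat n p" "transpose_mat A * D * transpose_mat A = transpose_mat A"
     "transpose_mat (transpose_mat A * D) = transpose_mat A * D"
    using left_symmetric_inverse_exists[of "transpose_mat A" p n] A by auto
  define C where "C = transpose_mat D"
  have C: "C \<in> carrier_mat p n" using D by (simp add: C_def)
  have CA: "transpose_mat A * D = transpose_mat (C * A)"
    using transpose_mult[OF C A] by (simp add: C_def)
  have C2: "transpose_mat (C * A) = C * A" using D(3) unfolding CA by simp
  have "transpose_mat (A * (C * A)) = transpose_mat A"
    using transpose_mult[of A n p "C * A" p] A C C2 D(2) CA by simp
  then have C1: "A * (C * A) = A" by (metis Matrix.transpose_transpose)
  have AC: "A * C \<in> carrier_mat n n" "C * A \<in> carrier_mat p p" "A * B \<in> carrier_mat n n" "B * A \<in> carrier_mat p p"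
    using A B C by auto
  have B1: "A * (B * A) = A" using B A by (simp add: assoc_mult_mat[of _ n p _ n _ p])
  define P where "P = C * A * B"
  have P: "P \<in> carrier_mat p n" using A B C by (simp add: P_def)
  have AP: "A * P = A * B"
    unfolding P_def using assoc_mult_mat[OF A AC(2) B(1)] C1 by simp
  have PA: "P * A = C * A"
    unfolding P_def using assoc_mult_mat[OF AC(2) B(1) A] assoc_mult_mat[OF C A AC(4)] B1 by simp
  have "P * A * P = P"
    unfolding PA unfolding P_def
    using assoc_mult_mat[OF AC(2,2) B(1)] assoc_mult_mat[OF C A AC(2)] C1 by simp
  then have "is_pinv A P"
    unfolding is_pinv_def using P AP PA B C2 by (simp add: n_def p_def)
  then show ?thesis by blast
qed

text \<open>The symmetric matrices \<open>A B\<close> and \<open>A C\<close> absorb each other from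
  the left, so transposing one product identifies them; likewise \<open>B A\<close> and
  \<open>C A\<close>. Then \<open>B = B A B = C A C = C\<close>.\<close>

lemma is_pinv_unique:
  assumes B: "is_pinv A B" and C: "is_pinv A C"
  shows "B = C"
proof -
  define n p where "n = dim_row A" and "p = dim_col A"
  have A: "A \<in> carrier_mat n p" by (simp add: n_def p_def)
  have Bc: "B \<in> carrier_mat p n" and Cc: "C \<in> carrier_mat p n"
    using B C by (auto simp: is_pinv_def n_def p_def)
  note c = A Bc Cc
  have cc: "A * B \<in> carrier_mat n n" "A * C \<in> carrier_mat n n" "B * A \<in> carrier_mat p p" "C * A \<in> carrier_mat p p"
    using c by auto
  have "A * C * (A * B) = A * C * A * B" "A * B * (A * C) = A * B * A * C"
    using assoc_mult_mat[OF cc(2) A Bc] assoc_mult_mat[OF cc(1) A Cc] by auto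
  then have 1: "A * C * (A * B) = A * B" "A * B * (A * C) = A * C"
    using B C by (auto simp: is_pinv_def)
  have "transpose_mat (A * B * (A * C)) = A * C * (A * B)"
    using transpose_mult[OF cc(1,2)] B C by (simp add: is_pinv_def)
  then have AB: "A * B = A * C" using 1 C by (simp add: is_pinv_def)
  have "B * A * (C * A) = B * (A * (C * A))" "C * A * (B * A) = C * (A * (B * A))"
    using assoc_mult_mat[OF Bc A cc(4)] assoc_mult_mat[OF Cc A cc(3)] by auto
  then have 2: "B * A * (C * A) = B * A" "C * A * (B * A) = C * A"
    using B C assoc_mult_mat[OF A Cc A] assoc_mult_mat[OF A Bc A] by (auto simp: is_pinv_def)
  have "transpose_mat (B * A * (C * A)) = C * A * (B * A)"
    using transpose_mult[OF cc(3,4)] B C by (simp add: is_pinv_def)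
  then have BA: "B * A = C * A" using 2 B by (simp add: is_pinv_def)
  have "B = B * (A * B)" using B assoc_mult_mat[OF Bc A Bc] by (simp add: is_pinv_def)
  also have "\<dots> = C * A * C" using AB BA assoc_mult_mat[OF Bc A Cc] by simp
  finally show ?thesis using C by (simp add: is_pinv_def)
qed

section \<open>The pseudo-inverse and the projection onto the row space\<close>

lemma is_pinv_pinv: "is_pinv A (pinv A)"
  unfolding pinv_def using is_pinv_exists[of A] is_pinv_unique by (metis theI')

lemma pinv_carrier: "A \<in> carrier_mat n p \<Longrightarrow> pinv A \<in> carrier_mat p n"
  using is_pinv_pinv[of A] by (auto simp: is_pinv_def)

text \<open>Symmetry of \<open>B A\<close> puts \<open>B A v\<close> into the row space, and
  \<open>A B A = A\<close> makes the remainder orthogonal to it. For uniqueness, the difference of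
  two candidates lies in the row space and is orthogonal to itself.\<close>

lemma proj_row_space_eq:
  fixes A :: "real mat"
  assumes A: "A \<in> carrier_mat n p" and v: "v \<in> carrier_vec p"
  shows "proj_row_space A v = pinv A *\<^sub>v (A *\<^sub>v v)"
proof -
  interpret vec_space "TYPE(real)" p .
  define B where "B = pinv A"
  have B: "B \<in> carrier_mat p n" unfolding B_def by (rule pinv_carrier[OF A])
  have pin: "A * B * A = A" "transpose_mat (B * A) = B * A"
    using is_pinv_pinv[of A] by (auto simp: is_pinv_def B_def)
  define u where "u = B *\<^sub>v (A *\<^sub>v v)"
  have u: "u \<in> carrier_vec p" using A B v by (simp add: u_def)
  have RS: "row_space A = {w \<in> carrier_vec p. \<exists>y\<in>carrier_vec n. transpose_mat A *\<^sub>v y = w}"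
    using row_space_eq[OF A] A by simp
  have "u = transpose_mat (B * A) *\<^sub>v v"
    using A B v by (simp add: u_def pin assoc_mult_mat_vec[of _ p n _ p])
  also have "\<dots> = transpose_mat A *\<^sub>v (transpose_mat B *\<^sub>v v)"
    using transpose_mult[OF B A] A B v by (simp add: assoc_mult_mat_vec[of _ p n _ p])
  finally have uR: "u \<in> row_space A" unfolding RS using u B v by auto
  have "A *\<^sub>v u = A * B * A *\<^sub>v v"
    using A B v by (simp add: u_def assoc_mult_mat_vec[of _ n p _ p] assoc_mult_mat_vec[of _ p n _ p])
  then have Au: "A *\<^sub>v u = A *\<^sub>v v" by (simp add: pin)
  have adj: "w \<bullet> (transpose_mat A *\<^sub>v y) = (A *\<^sub>v w) \<bullet> y" if "w \<in> carrier_vec p" "y \<in> carrier_vec n" for w y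
    using transpose_vec_mult_scalar[OF A that] A that
    by (simp add: comm_scalar_prod[of _ n] comm_scalar_prod[of _ p])
  have orth: "\<forall>w\<in>row_space A. (v - u) \<bullet> w = 0"
    using Au A u v by (auto simp: RS adj mult_minus_distrib_mat_vec[of _ n p] minus_scalar_prod_distrib[of _ n])
  show ?thesis unfolding proj_row_space_def carrier_matD(2)[OF A] B_def[symmetric] u_def[symmetric]
  proof (rule the_equality)
    show "u \<in> row_space A \<and> (\<forall>w\<in>row_space A. (v - u) \<bullet> w = 0)" using uR orth by simp
  next
    fix u' assume u': "u' \<in> row_space A \<and> (\<forall>w\<in>row_space A. (v - u') \<bullet> w = 0)"
    have u'c: "u' \<in> carrier_vec p" using u' RS by auto
    obtain y y' where y: "y \<in> carrier_vec n" "u = transpose_mat A *\<^sub>v y" "y' \<in> carrier_vec n" "u' = transpose_mat A *\<^sub>v y'"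
      using u' uR RS by auto
    have d: "u' - u = transpose_mat A *\<^sub>v (y' - y)"
      using y A by (simp add: mult_minus_distrib_mat_vec[of _ p n])
    have dR: "u' - u \<in> row_space A"
      unfolding RS using u u'c by (intro CollectI conjI bexI[of _ "y' - y"] d[symmetric]) (auto simp: y(1,3))
    have eq: "u' - u = (v - u) - (v - u')" using u u'c v by (intro eq_vecI) auto
    have "(u' - u) \<bullet> (u' - u) = (v - u) \<bullet> (u' - u) - (v - u') \<bullet> (u' - u)"
      using u u'c v by (subst (1) eq) (rule minus_scalar_prod_distrib[of _ p], auto)
    then have "(u' - u) \<bullet> (u' - u) = 0" using dR orth u' by auto
    then have "\<forall>i<p. (u' - u) $ i = 0"
      using u u'c by (simp add: scalar_prod_def sum_nonneg_eq_0_iff)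
    then show "u' = u" using u u'c by (intro eq_vecI) auto
  qed
qed

lemma mult_proj_row_space:
  fixes A :: "real mat"
  assumes A: "A \<in> carrier_mat n p" and v: "v \<in> carrier_vec p"
  shows "A *\<^sub>v proj_row_space A v = A *\<^sub>v v"
proof -
  have B: "pinv A \<in> carrier_mat p n" by (rule pinv_carrier[OF A])
  have "A *\<^sub>v proj_row_space A v = A * pinv A * A *\<^sub>v v"
    using A B v by (simp add: proj_row_space_eq assoc_mult_mat_vec[of _ n p _ p] assoc_mult_mat_vec[of _ p n _ p])
  then show ?thesis using is_pinv_pinv[of A] by (simp add: is_pinv_def)
qed

section \<open>Concentration of Rademacher suprema\<close>

text \<open>The index set is arbitrary because the variance bound is proved by induction on it;
  \<open>rademacher_vec q\<close> is the image for \<open>{..<q}\<close>.\<close>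

definition rademacher_fun :: "'i set \<Rightarrow> ('i \<Rightarrow> real) pmf" where
  "rademacher_fun A = Pi_pmf A 0 (\<lambda>_. pmf_of_set {-1, 1})"

lemma rademacher_fun_eq_pmf_of_set:
  assumes "finite A"
  shows "rademacher_fun A = pmf_of_set (PiE_dflt A 0 (\<lambda>_. {-1, 1}))"
  unfolding rademacher_fun_def using assms by (intro Pi_pmf_of_set) auto

lemma set_rademacher_fun:
  assumes "finite A"
  shows "set_pmf (rademacher_fun A) = PiE_dflt A 0 (\<lambda>_. {-1, 1})"
  using assms by (simp add: rademacher_fun_eq_pmf_of_set finite_PiE_dflt)

lemma finite_set_rademacher_fun: "finite A \<Longrightarrow> finite (set_pmf (rademacher_fun A))"
  by (simp add: set_rademacher_fun finite_PiE_dflt)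

lemma integrable_rademacher_fun:
  fixes F :: "('i \<Rightarrow> real) \<Rightarrow> real"
  shows "finite A \<Longrightarrow> integrable (rademacher_fun A) F"
  by (intro integrable_measure_pmf_finite finite_set_rademacher_fun)

lemma expectation_rademacher_fun_insert:
  fixes F :: "('i \<Rightarrow> real) \<Rightarrow> real"
  assumes "finite A" "i \<notin> A"
  shows "measure_pmf.expectation (rademacher_fun (insert i A)) F =
    (measure_pmf.expectation (rademacher_fun A) (\<lambda>h. F (h(i := 1))) +
     measure_pmf.expectation (rademacher_fun A) (\<lambda>h. F (h(i := -1)))) / 2"
proof -
  let ?U = "pmf_of_set {-1, 1 :: real}"
  have "rademacher_fun (insert i A) =
      bind_pmf ?U (\<lambda>y. map_pmf (\<lambda>h. h(i := y)) (rademacher_fun A))"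
    unfolding rademacher_fun_def using assms
    by (subst Pi_pmf_insert') (auto simp: map_pmf_def)
  then show ?thesis
    using assms by (simp add: pmf_expectation_bind_pmf_of_set finite_set_rademacher_fun field_simps)
qed

lemma rademacher_fun_sign_change:
  fixes s :: "'i \<Rightarrow> real"
  assumes A: "finite A" and s: "\<And>i. s i \<in> {-1, 1}"
  shows "map_pmf (\<lambda>h i. s i * h i) (rademacher_fun A) = rademacher_fun A"
proof -
  have ss: "s i * (s i * x) = x" "s i * s i = 1" for i x
    using s[of i] by auto
  have "bij_betw (\<lambda>h i. s i * h i) (PiE_dflt A 0 (\<lambda>_. {-1, 1})) (PiE_dflt A 0 (\<lambda>_. {-1, 1 :: real}))"
  proof (rule bij_betwI[where g = "\<lambda>h i. s i * h i"])
    show "(\<lambda>h i. s i * h i) \<in> PiE_dflt A 0 (\<lambda>_. {-1, 1}) \<rightarrow> PiE_dflt A 0 (\<lambda>_. {-1, 1})"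
      using s by (fastforce simp: PiE_dflt_def)
    then show "(\<lambda>h i. s i * h i) \<in> PiE_dflt A 0 (\<lambda>_. {-1, 1}) \<rightarrow> PiE_dflt A 0 (\<lambda>_. {-1, 1})" .
  qed (auto simp: ss)
  then show ?thesis
    unfolding rademacher_fun_eq_pmf_of_set[OF A]
    by (rule map_pmf_of_set_bij_betw) (auto simp: A finite_PiE_dflt)
qed

lemma rademacher_fun_flip:
  assumes "finite A"
  shows "map_pmf (\<lambda>h. h(i := - h i)) (rademacher_fun A) = rademacher_fun A"
proof -
  have "(\<lambda>h :: 'a \<Rightarrow> real. h(i := - h i)) = (\<lambda>h j. (if j = i then -1 else 1) * h j)"
    by (auto simp: fun_eq_iff)
  then show ?thesis
    using rademacher_fun_sign_change[OF assms, of "\<lambda>j. if j = i then -1 else 1"] by simp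
qed

text \<open>The discrete Poincare (Efron-Stein) inequality. Fixing coordinate \<open>i\<close>
  splits the variance into the mean of two conditional variances, covered by the induction
  hypothesis, and a quarter of the squared difference of the conditional means, which is at most a
  quarter of the influence of \<open>i\<close>. The constant is sharp for
  \<open>F h = h i\<close>.\<close>

lemma variance_rademacher_fun_le_influences:
  fixes F :: "('i \<Rightarrow> real) \<Rightarrow> real"
  assumes "finite A"
  shows "measure_pmf.variance (rademacher_fun A) F \<le>
    (\<Sum>i\<in>A. measure_pmf.expectation (rademacher_fun A) (\<lambda>h. (F h - F (h(i := - h i)))\<^sup>2)) / 4"
  using assms
proof (induction A arbitrary: F)
  case empty
  show ?case by (simp add: rademacher_fun_def)
next
  case (insert i A)
  note fin = \<open>finite A\<close>
  let ?E = "\<lambda>G :: ('i \<Rightarrow> real) \<Rightarrow> real. measure_pmf.expectation (rademacher_fun A) G"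
  define F1 where "F1 h = F (h(i := 1))" for h
  define F2 where "F2 h = F (h(i := -1))" for h
  have V: "measure_pmf.variance (rademacher_fun B) G =
      measure_pmf.expectation (rademacher_fun B) (\<lambda>h. (G h)\<^sup>2) - (measure_pmf.expectation (rademacher_fun B) G)\<^sup>2"
    if "finite B" for B :: "'i set" and G :: "('i \<Rightarrow> real) \<Rightarrow> real"
    by (rule measure_pmf.variance_eq; rule integrable_rademacher_fun[OF that])
  have E: "measure_pmf.expectation (rademacher_fun (insert i A)) G = (?E (\<lambda>h. G (h(i := 1))) + ?E (\<lambda>h. G (h(i := -1)))) / 2" for G
    using insert.hyps by (rule expectation_rademacher_fun_insert)
  have lin: "?E (\<lambda>h. F1 h - F2 h) = ?E F1 - ?E F2"
    by (intro Bochner_Integration.integral_diff integrable_rademacher_fun fin)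
  \<comment> \<open>Jensen's inequality, as nonnegativity of the variance of
    \<open>F1 - F2\<close>.\<close>
  have J: "(?E F1 - ?E F2)\<^sup>2 \<le> ?E (\<lambda>h. (F1 h - F2 h)\<^sup>2)"
  proof -
    have "0 \<le> measure_pmf.variance (rademacher_fun A) (\<lambda>h. F1 h - F2 h)"
      by (rule measure_pmf.variance_positive)
    also have "\<dots> = ?E (\<lambda>h. (F1 h - F2 h)\<^sup>2) - (?E (\<lambda>h. F1 h - F2 h))\<^sup>2"
      by (rule V[OF fin])
    finally show ?thesis unfolding lin by simp
  qed
  have upd: "(h(i := c))(j := d) = (h(j := d))(i := c)" if "j \<in> A" for h c d j
    using that insert.hyps by (intro fun_upd_twist) auto
  have I1: "measure_pmf.expectation (rademacher_fun (insert i A)) (\<lambda>h. (F h - F (h(j := - h j)))\<^sup>2) =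
      (?E (\<lambda>h. (F1 h - F1 (h(j := - h j)))\<^sup>2) + ?E (\<lambda>h. (F2 h - F2 (h(j := - h j)))\<^sup>2)) / 2"
    if "j \<in> A" for j
  proof -
    have "j \<noteq> i" using that insert.hyps by auto
    then show ?thesis unfolding E F1_def F2_def by (simp add: upd[OF that])
  qed
  have I2: "measure_pmf.expectation (rademacher_fun (insert i A)) (\<lambda>h. (F h - F (h(i := - h i)))\<^sup>2) =
      ?E (\<lambda>h. (F1 h - F2 h)\<^sup>2)"
    unfolding E F1_def F2_def by (simp add: power2_commute)
  have "measure_pmf.variance (rademacher_fun (insert i A)) F =
      (?E (\<lambda>h. (F1 h)\<^sup>2) + ?E (\<lambda>h. (F2 h)\<^sup>2)) / 2 - ((?E F1 + ?E F2) / 2)\<^sup>2"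
    unfolding V[OF finite.insertI[OF fin]] unfolding E F1_def[symmetric] F2_def[symmetric] by simp
  also have "\<dots> = (measure_pmf.variance (rademacher_fun A) F1 + measure_pmf.variance (rademacher_fun A) F2) / 2
      + (?E F1 - ?E F2)\<^sup>2 / 4"
    unfolding V[OF fin] by (simp add: power2_eq_square field_simps)
  also have "\<dots> \<le> ((\<Sum>j\<in>A. ?E (\<lambda>h. (F1 h - F1 (h(j := - h j)))\<^sup>2)) / 4
      + (\<Sum>j\<in>A. ?E (\<lambda>h. (F2 h - F2 (h(j := - h j)))\<^sup>2)) / 4) / 2 + ?E (\<lambda>h. (F1 h - F2 h)\<^sup>2) / 4"
    by (intro add_mono divide_right_mono insert.IH J) simp_all
  also have "\<dots> = (\<Sum>j\<in>insert i A. measure_pmf.expectation (rademacher_fun (insert i A))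
      (\<lambda>h. (F h - F (h(j := - h j)))\<^sup>2)) / 4"
    using insert.hyps by (simp add: I1 I2 sum.distrib add_divide_distrib flip: sum_divide_distrib)
  finally show ?case .
qed

text \<open>A one-sided bound suffices: the difference is controlled at whichever of the two points
  has the larger value. Its square is at most the sum of the squared bounds at both points, and
  these have equal means because a flip preserves the law. This doubles the influences and turns the
  factor 1/4 into 1/2.\<close>

lemma variance_rademacher_fun_le:
  fixes F :: "('i \<Rightarrow> real) \<Rightarrow> real"
  assumes A: "finite A"
    and diff: "\<And>h i. h \<in> set_pmf (rademacher_fun A) \<Longrightarrow> i \<in> A \<Longrightarrow> F h - F (h(i := - h i)) \<le> a h i"
    and nonneg: "\<And>h i. h \<in> set_pmf (rademacher_fun A) \<Longrightarrow> i \<in> A \<Longrightarrow> 0 \<le> a h i"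
    and V: "\<And>h. h \<in> set_pmf (rademacher_fun A) \<Longrightarrow> (\<Sum>i\<in>A. (a h i)\<^sup>2) \<le> V"
  shows "measure_pmf.variance (rademacher_fun A) F \<le> V / 2"
proof -
  let ?E = "\<lambda>G :: ('i \<Rightarrow> real) \<Rightarrow> real. measure_pmf.expectation (rademacher_fun A) G"
  note int = integrable_rademacher_fun[OF A]
  have flip: "?E (\<lambda>h. G (h(i := - h i))) = ?E G" for G i
  proof -
    have "?E G = measure_pmf.expectation (map_pmf (\<lambda>h. h(i := - h i)) (rademacher_fun A)) G"
      by (simp only: rademacher_fun_flip[OF A])
    also have "\<dots> = ?E (\<lambda>h. G (h(i := - h i)))" by simp
    finally show ?thesis ..
  qed
  have "?E (\<lambda>h. (F h - F (h(i := - h i)))\<^sup>2) \<le> 2 * ?E (\<lambda>h. (a h i)\<^sup>2)" if i: "i \<in> A" for i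
  proof -
    have "?E (\<lambda>h. (F h - F (h(i := - h i)))\<^sup>2) \<le> ?E (\<lambda>h. (a h i)\<^sup>2 + (a (h(i := - h i)) i)\<^sup>2)"
    proof (intro integral_mono_AE int, unfold AE_measure_pmf_iff, intro ballI)
      fix h assume h: "h \<in> set_pmf (rademacher_fun A)"
      define h' where "h' = h(i := - h i)"
      have h': "h' \<in> set_pmf (rademacher_fun A)"
        using h i unfolding set_rademacher_fun[OF A] h'_def by (fastforce simp: PiE_dflt_def)
      have "h'(i := - h' i) = h" by (simp add: h'_def)
      then have "F h' - F h \<le> a h' i" using diff[OF h' i] by simp
      moreover have "F h - F h' \<le> a h i" using diff[OF h i] by (simp add: h'_def)
      ultimately have "\<bar>F h - F h'\<bar> \<le> a h i \<or> \<bar>F h - F h'\<bar> \<le> a h' i" by linarith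
      then have "(F h - F h')\<^sup>2 \<le> (a h i)\<^sup>2 \<or> (F h - F h')\<^sup>2 \<le> (a h' i)\<^sup>2"
        using nonneg[OF h i] nonneg[OF h' i] by (simp add: abs_le_square_iff[symmetric])
      then have "(F h - F h')\<^sup>2 \<le> (a h i)\<^sup>2 + (a h' i)\<^sup>2"
        using zero_le_power2[of "a h i"] zero_le_power2[of "a h' i"] by linarith
      then show "(F h - F (h(i := - h i)))\<^sup>2 \<le> (a h i)\<^sup>2 + (a (h(i := - h i)) i)\<^sup>2"
        by (simp add: h'_def)
    qed
    also have "\<dots> = 2 * ?E (\<lambda>h. (a h i)\<^sup>2)"
      using flip[of "\<lambda>h. (a h i)\<^sup>2" i] by (subst Bochner_Integration.integral_add) (auto intro: int)
    finally show ?thesis .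
  qed
  then have "(\<Sum>i\<in>A. ?E (\<lambda>h. (F h - F (h(i := - h i)))\<^sup>2)) \<le> 2 * (\<Sum>i\<in>A. ?E (\<lambda>h. (a h i)\<^sup>2))"
    unfolding sum_distrib_left by (rule sum_mono)
  also have "(\<Sum>i\<in>A. ?E (\<lambda>h. (a h i)\<^sup>2)) = ?E (\<lambda>h. \<Sum>i\<in>A. (a h i)\<^sup>2)"
    by (intro Bochner_Integration.integral_sum[symmetric] int)
  also have "\<dots> \<le> ?E (\<lambda>_. V)"
    by (intro integral_mono_AE int) (simp add: AE_measure_pmf_iff V)
  also have "?E (\<lambda>_. V) = V" by simp
  finally have "(\<Sum>i\<in>A. ?E (\<lambda>h. (F h - F (h(i := - h i)))\<^sup>2)) / 4 \<le> V / 2" by linarith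
  with variance_rademacher_fun_le_influences[OF A, of F] show ?thesis by (rule order_trans)
qed

section \<open>Radius of symmetric sets and the concentration bound\<close>

lemma eucl_norm_eq_L2_set: "eucl_norm v = L2_set (\<lambda>i. v $ i) {..<dim_vec v}"
  by (simp add: eucl_norm_def L2_set_def scalar_prod_def power2_eq_square lessThan_atLeast0)

lemma eucl_norm_uminus: "eucl_norm (- v) = eucl_norm v"
  by (simp add: eucl_norm_eq_L2_set L2_set_def)

text \<open>A symmetric set cannot fit in a ball smaller than the one centered at the origin:
  \<open>2 t = (t - c) - (- t - c)\<close>.\<close>

lemma eucl_norm_le_set_radius:
  assumes T: "T \<subseteq> carrier_vec q" and sym: "\<And>t. t \<in> T \<Longrightarrow> - t \<in> T"
    and bdd: "\<And>t. t \<in> T \<Longrightarrow> eucl_norm t \<le> R" and t: "t \<in> T"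
  shows "eucl_norm t \<le> set_radius q T"
  unfolding set_radius_def
proof (rule cInf_greatest)
  have "0 \<le> R" using bdd[OF t] by (simp add: eucl_norm_eq_L2_set order_trans[OF L2_set_nonneg])
  moreover have "\<forall>t\<in>T. eucl_norm (t - 0\<^sub>v q) \<le> R"
    using bdd T by auto
  ultimately show "{\<rho>. \<rho> \<ge> 0 \<and> (\<exists>c \<in> carrier_vec q. \<forall>t\<in>T. eucl_norm (t - c) \<le> \<rho>)} \<noteq> {}"
    by (auto intro!: exI[of _ R] bexI[of _ "0\<^sub>v q"])
next
  fix \<rho> assume "\<rho> \<in> {\<rho>. \<rho> \<ge> 0 \<and> (\<exists>c \<in> carrier_vec q. \<forall>t\<in>T. eucl_norm (t - c) \<le> \<rho>)}"
  then obtain c where c: "c \<in> carrier_vec q" "\<And>t. t \<in> T \<Longrightarrow> eucl_norm (t - c) \<le> \<rho>" by auto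
  have tq: "t \<in> carrier_vec q" using t T by auto
  have "2 * eucl_norm t = L2_set (\<lambda>i. (t - c) $ i + (- (- t - c)) $ i) {..<q}"
    using tq c(1) by (simp add: eucl_norm_eq_L2_set L2_set_right_distrib) (rule L2_set_cong, auto)
  also have "\<dots> \<le> L2_set (\<lambda>i. (t - c) $ i) {..<q} + L2_set (\<lambda>i. (- (- t - c)) $ i) {..<q}"
    by (rule L2_set_triangle_ineq)
  also have "\<dots> = eucl_norm (t - c) + eucl_norm (- t - c)"
    using tq c(1) eucl_norm_uminus[of "- t - c"] by (simp add: eucl_norm_eq_L2_set)
  also have "\<dots> \<le> \<rho> + \<rho>"
    using c(2)[OF t] c(2)[OF sym[OF t]] by (rule add_mono)
  finally show "eucl_norm t \<le> \<rho>" by simp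
qed

lemma bdd_above_scalar_prod:
  assumes T: "T \<subseteq> carrier_vec q" and bdd: "\<And>t. t \<in> T \<Longrightarrow> eucl_norm t \<le> R"
    and b: "b \<in> carrier_vec q"
  shows "bdd_above ((\<lambda>t. t \<bullet> b) ` T)"
proof (rule bdd_aboveI2)
  fix t assume t: "t \<in> T"
  then have tq: "t \<in> carrier_vec q" using T by auto
  have "t \<bullet> b \<le> (\<Sum>i<q. \<bar>t $ i\<bar> * \<bar>b $ i\<bar>)"
    using tq b by (simp add: scalar_prod_def lessThan_atLeast0) (intro sum_mono, simp flip: abs_mult)
  also have "\<dots> \<le> (\<Sum>i<q. R * \<bar>b $ i\<bar>)"
  proof (intro sum_mono mult_right_mono)
    fix i assume "i \<in> {..<q}"
    then have "\<bar>t $ i\<bar> \<le> eucl_norm t"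
      using tq member_le_L2_set[of "{..<q}" i "\<lambda>i. \<bar>t $ i\<bar>"] by (simp add: eucl_norm_eq_L2_set L2_set_def)
    then show "\<bar>t $ i\<bar> \<le> R" using bdd[OF t] by simp
  qed simp
  finally show "t \<bullet> b \<le> (\<Sum>i<q. R * \<bar>b $ i\<bar>)" .
qed

text \<open>Chebyshev's inequality suffices here: an approximate maximizer \<open>t\<close> at \<open>b\<close> bounds the drop of the
  supremum under a flip of \<open>b\<^sub>i\<close> by \<open>2 \<bar>t\<^sub>i\<bar>\<close>, so the variance is at most twice the squared radius.\<close>

lemma rademacher_sup_concentration:
  assumes T: "T \<subseteq> carrier_vec q" "T \<noteq> {}" and sym: "\<And>t. t \<in> T \<Longrightarrow> - t \<in> T"
    and bdd: "\<And>t. t \<in> T \<Longrightarrow> eucl_norm t \<le> R" and l: "l > 0"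
  shows "measure_pmf.prob (rademacher_vec q) {b. U_plus q T l < (SUP t\<in>T. t \<bullet> b)} \<le> 2 / l\<^sup>2"
proof -
  define A where "A = {..<q}"
  have A: "finite A" by (simp add: A_def)
  define S where "S = set_pmf (rademacher_fun A)"
  have S: "S = PiE_dflt A 0 (\<lambda>_. {-1, 1})" unfolding S_def by (rule set_rademacher_fun[OF A])
  have finS: "finite S" unfolding S_def by (rule finite_set_rademacher_fun[OF A])
  define F where "F h = (SUP t\<in>T. t \<bullet> Matrix.vec q h)" for h
  define r where "r = set_radius q T"
  define \<mu> where "\<mu> = measure_pmf.expectation (rademacher_fun A) F"
  have rv: "rademacher_vec q = map_pmf (Matrix.vec q) (rademacher_fun A)"
    by (simp add: rademacher_vec_def rademacher_fun_def A_def)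
  have U: "U_plus q T l = \<mu> + l * r"
    by (simp add: U_plus_def rademacher_width_def rv \<mu>_def r_def F_def[abs_def])
  have r: "eucl_norm t \<le> r" if "t \<in> T" for t
    unfolding r_def using T(1) sym bdd that by (rule eucl_norm_le_set_radius)
  have r0: "0 \<le> r"
    using T(2) r by (fastforce simp: eucl_norm_eq_L2_set intro: order_trans[OF L2_set_nonneg])
  have bddF: "bdd_above ((\<lambda>t. t \<bullet> Matrix.vec q h) ` T)" for h
    by (rule bdd_above_scalar_prod[OF T(1) bdd]) auto
  \<comment> \<open>The supremum over an infinite set need not be attained; the strict slack above
    \<open>r\<close> pays for near-maximizers.\<close>
  have var: "measure_pmf.variance (rademacher_fun A) F \<le> 2 * \<rho>\<^sup>2" if \<rho>: "\<rho> > r" for \<rho>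
  proof -
    \<comment> \<open>The errors \<delta> in all \<open>q\<close> coordinates together must fit into
      \<open>2 * (\<rho> - r)\<close>; the added 1 avoids division by zero at
      \<open>q = 0\<close>.\<close>
    define \<delta> where "\<delta> = 2 * (\<rho> - r) / (real q + 1)"
    have \<delta>: "\<delta> > 0" "real q * \<delta> \<le> 2 * (\<rho> - r)"
      using \<rho> by (auto simp: \<delta>_def field_simps mult_left_mono)
    have "\<exists>t\<in>T. F h - \<delta> < t \<bullet> Matrix.vec q h" for h
      using \<delta>(1) less_cSUP_iff[OF T(2) bddF, of "F h - \<delta>" h] by (simp add: F_def)
    then obtain t where t: "\<And>h. t h \<in> T" "\<And>h. F h - \<delta> < t h \<bullet> Matrix.vec q h" by metis
    have tq: "t h \<in> carrier_vec q" for h using t(1) T(1) by auto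
    have "measure_pmf.variance (rademacher_fun A) F \<le> (2 * \<rho>)\<^sup>2 / 2"
    proof (rule variance_rademacher_fun_le[OF A, where a = "\<lambda>h i. 2 * \<bar>t h $ i\<bar> + \<delta>"])
      fix h i assume h: "h \<in> set_pmf (rademacher_fun A)" and i: "i \<in> A"
      define h' where "h' = h(i := - h i)"
      have "\<bar>h i\<bar> = 1" using h i unfolding S_def[symmetric] S by (auto simp: PiE_dflt_def)
      have le: "t h \<bullet> Matrix.vec q h' \<le> F h'"
        unfolding F_def by (rule cSUP_upper[OF t(1) bddF])
      have "t h \<bullet> Matrix.vec q h - t h \<bullet> Matrix.vec q h' = (\<Sum>j<q. t h $ j * h j - t h $ j * h' j)"
        by (simp add: scalar_prod_def lessThan_atLeast0 sum_subtractf)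
      moreover have "\<dots> = (\<Sum>j<q. if j = i then 2 * (t h $ i * h i) else 0)"
        by (rule sum.cong) (auto simp: h'_def)
      ultimately have "t h \<bullet> Matrix.vec q h - t h \<bullet> Matrix.vec q h' = 2 * (t h $ i * h i)"
        using i by (simp add: A_def)
      moreover have "t h $ i * h i \<le> \<bar>t h $ i\<bar>"
        using \<open>\<bar>h i\<bar> = 1\<close> abs_ge_self[of "t h $ i * h i"] by (simp add: abs_mult)
      ultimately show "F h - F (h(i := - h i)) \<le> 2 * \<bar>t h $ i\<bar> + \<delta>"
        using t(2)[of h] le by (simp add: h'_def)
    next
      fix h assume "h \<in> set_pmf (rademacher_fun A)"
      have "L2_set (\<lambda>i. 2 * \<bar>t h $ i\<bar> + \<delta>) A \<le> L2_set (\<lambda>i. 2 * \<bar>t h $ i\<bar>) A + L2_set (\<lambda>_. \<delta>) A"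
        by (rule L2_set_triangle_ineq)
      also have "L2_set (\<lambda>i. 2 * \<bar>t h $ i\<bar>) A = 2 * eucl_norm (t h)"
        using tq[of h] L2_set_right_distrib[of 2 "\<lambda>i. \<bar>t h $ i\<bar>" A]
        by (simp add: eucl_norm_eq_L2_set A_def L2_set_def)
      also have "L2_set (\<lambda>_. \<delta>) A \<le> real q * \<delta>"
        using L2_set_le_sum[of A "\<lambda>_. \<delta>"] \<delta>(1) by (simp add: A_def)
      finally have "L2_set (\<lambda>i. 2 * \<bar>t h $ i\<bar> + \<delta>) A \<le> 2 * \<rho>"
        using r[OF t(1)[of h]] \<delta>(2) by simp
      then have "(L2_set (\<lambda>i. 2 * \<bar>t h $ i\<bar> + \<delta>) A)\<^sup>2 \<le> (2 * \<rho>)\<^sup>2"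
        by (intro power_mono L2_set_nonneg)
      then show "(\<Sum>i\<in>A. (2 * \<bar>t h $ i\<bar> + \<delta>)\<^sup>2) \<le> (2 * \<rho>)\<^sup>2"
        by (simp add: L2_set_def sum_nonneg)
    qed (use \<delta> in auto)
    then show ?thesis by (simp add: power_mult_distrib)
  qed
  \<comment> \<open>The law has finite support, so the excesses over the mean beyond
    \<open>l * r\<close> have a minimum, still strictly above \<open>l * r\<close>. Raising the
    threshold to this minimum \<open>l * \<rho>\<close> provides the slack that \<open>var\<close>
    asks for and gives exactly \<open>2 / l^2\<close> without a limit, also for
    \<open>r = 0\<close>, where Chebyshev at \<open>l * r\<close> would be void.\<close>
  define D where "D = {F h - \<mu> | h. h \<in> S \<and> \<mu> + l * r < F h}"
  have "measure_pmf.prob (rademacher_vec q) {b. U_plus q T l < (SUP t\<in>T. t \<bullet> b)}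
      = measure_pmf.prob (rademacher_fun A) ({h. \<mu> + l * r < F h} \<inter> S)"
    unfolding rv U S_def by (simp add: measure_Int_set_pmf F_def vimage_def)
  also have "\<dots> \<le> 2 / l\<^sup>2"
  proof (cases "D = {}")
    case True
    then have "{h. \<mu> + l * r < F h} \<inter> S = {}" by (auto simp: D_def)
    then show ?thesis by simp
  next
    case False
    have finD: "finite D" unfolding D_def using finS by simp
    define \<rho> where "\<rho> = Min D / l"
    have "Min D \<in> D" using finD False by (rule Min_in)
    then have "l * r < Min D" by (auto simp: D_def)
    then have \<rho>: "r < \<rho>" using l by (simp add: \<rho>_def field_simps)
    have Dl: "Min D = l * \<rho>" using l by (simp add: \<rho>_def)
    have pos: "0 < l * \<rho>" using l r0 \<rho> by simp
    have "{h. \<mu> + l * r < F h} \<inter> S \<subseteq> {h. l * \<rho> \<le> \<bar>F h - \<mu>\<bar>}"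
    proof
      fix h assume h: "h \<in> {h. \<mu> + l * r < F h} \<inter> S"
      then have "F h - \<mu> \<in> D" by (auto simp: D_def)
      then have "Min D \<le> F h - \<mu>" using finD by simp
      then show "h \<in> {h. l * \<rho> \<le> \<bar>F h - \<mu>\<bar>}" using Dl by simp
    qed
    then have "measure_pmf.prob (rademacher_fun A) ({h. \<mu> + l * r < F h} \<inter> S)
       \<le> measure_pmf.prob (rademacher_fun A) {h. l * \<rho> \<le> \<bar>F h - \<mu>\<bar>}"
      by (intro measure_pmf.finite_measure_mono) auto
    also have "\<dots> \<le> measure_pmf.variance (rademacher_fun A) F / (l * \<rho>)\<^sup>2"
      using measure_pmf.Chebyshev_inequality[of F "rademacher_fun A" "l * \<rho>"] pos integrable_rademacher_fun[OF A]
      by (simp add: \<mu>_def)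
    also have "\<dots> \<le> 2 * \<rho>\<^sup>2 / (l * \<rho>)\<^sup>2"
      using var[OF \<rho>] by (intro divide_right_mono) auto
    also have "\<dots> = 2 / l\<^sup>2" using pos r0 \<rho> by (simp add: power_mult_distrib)
    finally show ?thesis .
  qed
  finally show ?thesis .
qed

section \<open>Sup-norms under random signs\<close>

lemma sup_norm_le_iff: "sup_norm v \<le> c \<longleftrightarrow> 0 \<le> c \<and> (\<forall>i<dim_vec v. \<bar>v $ i\<bar> \<le> c)"
  by (auto simp: sup_norm_def)

lemma sup_norm_nonneg: "0 \<le> sup_norm v"
  by (simp add: sup_norm_def)

lemma abs_index_le_sup_norm: "i < dim_vec v \<Longrightarrow> \<bar>v $ i\<bar> \<le> sup_norm v"
  using sup_norm_le_iff[of v "sup_norm v"] by simp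

lemma sup_norm_add_le:
  assumes "v \<in> carrier_vec q" "w \<in> carrier_vec q"
  shows "sup_norm (v + w) \<le> sup_norm v + sup_norm w"
  unfolding sup_norm_le_iff using assms sup_norm_nonneg[of v] sup_norm_nonneg[of w]
  by (auto intro!: order_trans[OF abs_triangle_ineq] add_mono abs_index_le_sup_norm)

lemma sup_norm_uminus: "sup_norm (- v) = sup_norm v"
  by (simp add: sup_norm_def cong: image_cong_simp)

lemma sup_norm_smult_le: "sup_norm (c \<cdot>\<^sub>v v) \<le> \<bar>c\<bar> * sup_norm v"
  by (auto simp: sup_norm_le_iff abs_mult sup_norm_nonneg intro!: mult_left_mono abs_index_le_sup_norm)

lemma diag_mult_vec:
  assumes "b \<in> carrier_vec n" "v \<in> carrier_vec n"
  shows "diag b *\<^sub>v v = Matrix.vec n (\<lambda>i. b $ i * v $ i)"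
proof (rule eq_vecI)
  fix i assume "i < dim_vec (Matrix.vec n (\<lambda>i. b $ i * v $ i))"
  then have i: "i < n" by simp
  have "(diag b *\<^sub>v v) $ i = (\<Sum>j = 0..<n. (if i = j then b $ j else 0) * v $ j)"
    using assms i by (simp add: diag_def mat_diag_def scalar_prod_def)
  also have "\<dots> = (\<Sum>j = 0..<n. if i = j then b $ j * v $ j else 0)"
    by (rule sum.cong) auto
  also have "\<dots> = b $ i * v $ i" using i by simp
  finally show "(diag b *\<^sub>v v) $ i = Matrix.vec n (\<lambda>i. b $ i * v $ i) $ i" using i by simp
qed (use assms in \<open>simp add: diag_def mat_diag_def\<close>)

lemma diag_carrier: "b \<in> carrier_vec n \<Longrightarrow> diag b \<in> carrier_mat n n"
  by (simp add: diag_def)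

lemma mult_mat_diag_index:
  fixes B :: "real mat"
  assumes B: "B \<in> carrier_mat p n" and b: "b \<in> carrier_vec n" and v: "v \<in> carrier_vec n" and j: "j < p"
  shows "(B *\<^sub>v (diag b *\<^sub>v v)) $ j = (\<Sum>i<n. B $$ (j, i) * (b $ i * v $ i))"
  using assms by (simp add: diag_mult_vec scalar_prod_def lessThan_atLeast0)

section \<open>Rademacher vectors as uniform sign vectors\<close>

definition sign_vecs :: "nat \<Rightarrow> real vec set" where
  "sign_vecs n = {s \<in> carrier_vec n. \<forall>i<n. s $ i \<in> {-1, 1}}"

lemma sign_group_eq: "sign_group n = diag ` sign_vecs n"
  by (auto simp: sign_group_def sign_vecs_def)

lemma inj_on_diag: "inj_on diag (carrier_vec n)"
proof (rule inj_onI)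
  fix v w :: "real vec" assume v: "v \<in> carrier_vec n" and w: "w \<in> carrier_vec n" and eq: "diag v = diag w"
  have "diag u $$ (i, i) = u $ i" if "u \<in> carrier_vec n" "i < n" for u i
    using that by (simp add: diag_def mat_diag_def)
  then show "v = w" using v w eq by (intro eq_vecI) (auto, metis)
qed

lemma sign_vecs_eq_image: "sign_vecs n = Matrix.vec n ` PiE_dflt {..<n} 0 (\<lambda>_. {-1, 1})"
proof
  show "sign_vecs n \<subseteq> Matrix.vec n ` PiE_dflt {..<n} 0 (\<lambda>_. {-1, 1})"
  proof
    fix s assume s: "s \<in> sign_vecs n"
    then have "s = Matrix.vec n (\<lambda>i. if i < n then s $ i else 0)"
      by (intro eq_vecI) (auto simp: sign_vecs_def)
    moreover have "(\<lambda>i. if i < n then s $ i else 0) \<in> PiE_dflt {..<n} 0 (\<lambda>_. {-1, 1})"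
      using s by (auto simp: sign_vecs_def PiE_dflt_def)
    ultimately show "s \<in> Matrix.vec n ` PiE_dflt {..<n} 0 (\<lambda>_. {-1, 1})" by blast
  qed
qed (auto simp: sign_vecs_def PiE_dflt_def)

lemma finite_sign_vecs: "finite (sign_vecs n)"
  unfolding sign_vecs_eq_image by (intro finite_imageI finite_PiE_dflt) auto

lemma sign_vecs_nonempty: "sign_vecs n \<noteq> {}"
  unfolding sign_vecs_eq_image by auto

lemma rademacher_vec_eq_pmf_of_set: "rademacher_vec n = pmf_of_set (sign_vecs n)"
proof -
  have "inj_on (Matrix.vec n) (PiE_dflt {..<n} 0 (\<lambda>_. {-1, 1 :: real}))"
  proof (rule inj_onI, rule ext)
    fix f g :: "nat \<Rightarrow> real" and i
    assume f: "f \<in> PiE_dflt {..<n} 0 (\<lambda>_. {-1, 1})" "g \<in> PiE_dflt {..<n} 0 (\<lambda>_. {-1, 1})"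
      and eq: "Matrix.vec n f = Matrix.vec n g"
    have "Matrix.vec n f $ i = Matrix.vec n g $ i" using eq by simp
    then show "f i = g i" using f by (cases "i < n") (auto simp: PiE_dflt_def)
  qed
  then show ?thesis
    unfolding rademacher_vec_def sign_vecs_eq_image rademacher_fun_def[symmetric]
      rademacher_fun_eq_pmf_of_set[OF finite_lessThan]
    by (rule map_pmf_of_set_inj) (auto simp: finite_PiE_dflt)
qed

text \<open>Multiplication by \<open>diag s\<close> is an involution of \<open>sign_vecs n\<close>,
  on which the law is uniform. It lets a noise vector be replaced by its absolute values.\<close>

lemma prob_rademacher_vec_sign_change:
  assumes s: "s \<in> sign_vecs n"
  shows "measure_pmf.prob (rademacher_vec n) {b. P (diag s *\<^sub>v b)} = measure_pmf.prob (rademacher_vec n) {b. P b}"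
proof -
  have ss: "diag s *\<^sub>v (diag s *\<^sub>v b) = b" if "b \<in> sign_vecs n" for b
    using that s by (intro eq_vecI) (auto simp: sign_vecs_def diag_mult_vec[of _ n])
  have m: "diag s *\<^sub>v b \<in> sign_vecs n" if "b \<in> sign_vecs n" for b
    using that s by (fastforce simp: sign_vecs_def diag_mult_vec[of _ n])
  have "bij_betw ((*\<^sub>v) (diag s)) (sign_vecs n) (sign_vecs n)"
    by (rule bij_betwI[where g = "(*\<^sub>v) (diag s)"]) (auto simp: ss m)
  then have "map_pmf ((*\<^sub>v) (diag s)) (rademacher_vec n) = rademacher_vec n"
    unfolding rademacher_vec_eq_pmf_of_set
    by (rule map_pmf_of_set_bij_betw[OF _ sign_vecs_nonempty finite_sign_vecs])
  then have "measure_pmf.prob (rademacher_vec n) {b. P b} =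
      measure_pmf.prob (map_pmf ((*\<^sub>v) (diag s)) (rademacher_vec n)) {b. P b}" by simp
  also have "\<dots> = measure_pmf.prob (rademacher_vec n) {b. P (diag s *\<^sub>v b)}"
    by (simp add: vimage_def)
  finally show ?thesis ..
qed

lemma prob_rademacher_vec_mono:
  assumes "\<And>b. b \<in> sign_vecs n \<Longrightarrow> P b \<Longrightarrow> Q b"
  shows "measure_pmf.prob (rademacher_vec n) {b. P b} \<le> measure_pmf.prob (rademacher_vec n) {b. Q b}"
  using assms
  by (intro measure_pmf.finite_measure_mono_AE)
     (auto simp: AE_measure_pmf_iff rademacher_vec_eq_pmf_of_set finite_sign_vecs sign_vecs_nonempty)

text \<open>Supplies the side condition \<open>0 \<le> c\<close> of \<open>sup_norm_le_iff\<close>,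
  which comes from the 0 inserted in \<open>sup_norm\<close>: the values at \<open>t\<close> and
  \<open>- t\<close> have opposite signs.\<close>

lemma symmetric_sup_nonneg:
  assumes "T \<subseteq> carrier_vec q" "T \<noteq> {}" "\<And>t. t \<in> T \<Longrightarrow> - t \<in> T" "\<And>t. t \<in> T \<Longrightarrow> eucl_norm t \<le> R"
    and b: "b \<in> carrier_vec q"
  shows "0 \<le> (SUP t\<in>T. t \<bullet> b)"
proof -
  obtain t where t: "t \<in> T" using assms(2) by auto
  have bdd: "bdd_above ((\<lambda>t. t \<bullet> b) ` T)" by (rule bdd_above_scalar_prod[OF assms(1,4) b])
  have "t \<bullet> b \<le> (SUP t\<in>T. t \<bullet> b)" "(- t) \<bullet> b \<le> (SUP t\<in>T. t \<bullet> b)"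
    using cSUP_upper[OF _ bdd] t assms(3) by auto
  moreover have "(- t) \<bullet> b = - (t \<bullet> b)"
    using t assms(1) b by (auto simp: subset_iff)
  ultimately show ?thesis by linarith
qed

lemma eucl_norm_le_sum_abs: "eucl_norm v \<le> (\<Sum>i<dim_vec v. \<bar>v $ i\<bar>)"
  unfolding eucl_norm_eq_L2_set by (rule L2_set_le_sum_abs)

text \<open>Both applications of the concentration bound have this form: the values \<open>(B diag(b) x)\<^sub>j\<close> and
  their negatives are inner products of \<open>b\<close> with elements of \<open>T\<close>.\<close>

lemma prob_sup_norm_le:
  assumes T: "T \<subseteq> carrier_vec q" "T \<noteq> {}" and sym: "\<And>t. t \<in> T \<Longrightarrow> - t \<in> T"
    and bdd: "\<And>t. t \<in> T \<Longrightarrow> eucl_norm t \<le> R" and l: "l > 0"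
    and rep: "\<And>b j. b \<in> carrier_vec q \<Longrightarrow> j < dim_vec (g b) \<Longrightarrow> \<exists>t\<in>T. g b $ j = t \<bullet> b"
    and c: "U_plus q T l \<le> c"
  shows "measure_pmf.prob (rademacher_vec q) {b. c < sup_norm (g b)} \<le> 2 / l\<^sup>2"
proof -
  have "measure_pmf.prob (rademacher_vec q) {b. c < sup_norm (g b)} \<le>
      measure_pmf.prob (rademacher_vec q) {b. U_plus q T l < (SUP t\<in>T. t \<bullet> b)}"
  proof (rule prob_rademacher_vec_mono)
    fix b assume b: "b \<in> sign_vecs q" and cb: "c < sup_norm (g b)"
    have bq: "b \<in> carrier_vec q" using b by (simp add: sign_vecs_def)
    have up: "t \<bullet> b \<le> (SUP t\<in>T. t \<bullet> b)" if "t \<in> T" for t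
      by (rule cSUP_upper[OF that bdd_above_scalar_prod[OF T(1) bdd bq]])
    have "\<bar>g b $ j\<bar> \<le> (SUP t\<in>T. t \<bullet> b)" if j: "j < dim_vec (g b)" for j
    proof -
      obtain t where t: "t \<in> T" "g b $ j = t \<bullet> b" using rep[OF bq j] by auto
      have "(- t) \<bullet> b = - (t \<bullet> b)" using t T(1) bq by (auto simp: subset_iff)
      then show ?thesis using up[OF t(1)] up[OF sym[OF t(1)]] t(2) by linarith
    qed
    then have "sup_norm (g b) \<le> (SUP t\<in>T. t \<bullet> b)"
      unfolding sup_norm_le_iff using symmetric_sup_nonneg[OF T sym bdd bq] by auto
    then show "U_plus q T l < (SUP t\<in>T. t \<bullet> b)" using c cb by linarith
  qed
  also have "\<dots> \<le> 2 / l\<^sup>2"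
    by (rule rademacher_sup_concentration[OF T sym bdd l])
  finally show ?thesis .
qed

lemma set_rows_append_uminus:
  fixes A :: "real mat"
  assumes A: "A \<in> carrier_mat p n"
  shows "set (rows (A @\<^sub>r (- A))) = {Matrix.row A j | j. j < p} \<union> {- Matrix.row A j | j. j < p}"
proof -
  have dim: "dim_row (A @\<^sub>r (- A)) = p + p" using A by (simp add: append_rows_def)
  have 1: "Matrix.row (A @\<^sub>r (- A)) i = Matrix.row A i" if "i < p" for i
    using that A by (intro eq_vecI) (auto simp: append_rows_def)
  have 2: "Matrix.row (A @\<^sub>r (- A)) (p + i) = - Matrix.row A i" if "i < p" for i
    using that A by (intro eq_vecI) (auto simp: append_rows_def)
  have "{0..<p + p} = {..<p} \<union> (\<lambda>i. p + i) ` {..<p}"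
    by (auto simp: image_iff) (metis add_diff_inverse_nat add_less_cancel_left lessThan_iff)
  then have "set (rows (A @\<^sub>r (- A))) = Matrix.row (A @\<^sub>r (- A)) ` {..<p} \<union> (\<lambda>i. Matrix.row (A @\<^sub>r (- A)) (p + i)) ` {..<p}"
    unfolding rows_def set_map set_upt dim by (simp add: image_Un image_image)
  also have "\<dots> = Matrix.row A ` {..<p} \<union> (\<lambda>i. - Matrix.row A i) ` {..<p}"
    by (simp add: 1 2 cong: image_cong_simp)
  finally show ?thesis by (auto simp: image_def)
qed

text \<open>The signs of \<open>v\<close> are absorbed into the Rademacher vector, so the hypothesis
  may speak of absolute values only. What remains are the inner products of \<open>b\<close> with
  the rows of \<open>noise_mat\<close>, a finite symmetric set.\<close>

lemma prob_noise_le: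
  assumes X: "X \<in> carrier_mat n p" and v: "v \<in> carrier_vec n" and l: "l > 0" and t: "t > 0"
    and U: "U_plus n (set (rows (noise_mat X (map_vec abs v)))) l \<le> t"
  shows "measure_pmf.prob (rademacher_vec n) {b. t < sup_norm (pinv X *\<^sub>v (diag b *\<^sub>v v))} \<le> 2 / l\<^sup>2"
\<comment> \<open>Without rows the set in \<open>prob_sup_norm_le\<close> would be empty; the
  statistic is then 0, below \<open>t\<close>.\<close>
proof (cases "p = 0")
  case True
  have "sup_norm (pinv X *\<^sub>v (diag b *\<^sub>v v)) = 0" for b
    using pinv_carrier[OF X] True by (simp add: sup_norm_def)
  then show ?thesis using t by simp
next
  case False
  define B where "B = pinv X"
  have B: "B \<in> carrier_mat p n" unfolding B_def by (rule pinv_carrier[OF X])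
  define a where "a = map_vec abs v"
  define s where "s = Matrix.vec n (\<lambda>i. if v $ i < 0 then -1 else 1 :: real)"
  have a: "a \<in> carrier_vec n" using v by (simp add: a_def)
  have s: "s \<in> sign_vecs n" by (auto simp: s_def sign_vecs_def)
  have sa: "diag (diag s *\<^sub>v b) *\<^sub>v a = diag b *\<^sub>v v" if "b \<in> carrier_vec n" for b
    using that s v a
    by (intro eq_vecI) (auto simp: diag_mult_vec[of _ n] sign_vecs_def, auto simp: s_def a_def split: if_splits)
  define A where "A = B * diag a"
  have A: "A \<in> carrier_mat p n" using B diag_carrier[OF a] by (simp add: A_def)
  have Arow: "Matrix.row A j \<bullet> b = (B *\<^sub>v (diag b *\<^sub>v a)) $ j" if "j < p" "b \<in> carrier_vec n" for j b
  proof -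
    have "A = Matrix.mat p n (\<lambda>(i, j). B $$ (i, j) * a $ j)"
      unfolding A_def diag_def using mat_diag_mult_right[OF B] a by simp
    then show ?thesis
      using that a by (simp add: mult_mat_diag_index[OF B] scalar_prod_def lessThan_atLeast0 mult_ac)
  qed
  define T where "T = set (rows (noise_mat X a))"
  have T: "T = {Matrix.row A j | j. j < p} \<union> {- Matrix.row A j | j. j < p}"
    unfolding T_def noise_mat_def B_def[symmetric] A_def[symmetric] by (rule set_rows_append_uminus[OF A])
  have "finite T" by (simp add: T_def)
  have "measure_pmf.prob (rademacher_vec n) {b. t < sup_norm (B *\<^sub>v (diag b *\<^sub>v v))}
     \<le> measure_pmf.prob (rademacher_vec n) {b. t < sup_norm (B *\<^sub>v (diag (diag s *\<^sub>v b) *\<^sub>v a))}"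
    by (rule prob_rademacher_vec_mono) (simp add: sa sign_vecs_def)
  also have "\<dots> = measure_pmf.prob (rademacher_vec n) {b. t < sup_norm (B *\<^sub>v (diag b *\<^sub>v a))}"
    by (rule prob_rademacher_vec_sign_change[OF s])
  also have "\<dots> \<le> 2 / l\<^sup>2"
  proof (rule prob_sup_norm_le[of T])
    show "T \<subseteq> carrier_vec n" unfolding T using A by auto
    show "T \<noteq> {}" unfolding T using False by auto
    show "- t \<in> T" if "t \<in> T" for t using that unfolding T by auto
    show "eucl_norm t \<le> Max (eucl_norm ` T)" if "t \<in> T" for t using that \<open>finite T\<close> by simp
    show "\<exists>t\<in>T. (B *\<^sub>v (diag b *\<^sub>v a)) $ j = t \<bullet> b"
      if "b \<in> carrier_vec n" "j < dim_vec (B *\<^sub>v (diag b *\<^sub>v a))" for b j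
      using that B unfolding T by (intro bexI[of _ "Matrix.row A j"]) (auto simp: Arow)
    show "U_plus n T l \<le> t" using U by (simp add: T_def a_def)
  qed (rule l)
  finally show ?thesis by (simp add: B_def)
qed

text \<open>Entry \<open>j\<close> of \<open>B diag(b) X w\<close> is the inner product of
  \<open>b\<close> with the member of \<open>signal_set X\<close> given by \<open>w\<close> and
  \<open>j\<close>. Replacing \<open>w\<close> by \<open>- w\<close> shows that the set is
  symmetric.\<close>

lemma prob_signal_le:
  assumes X: "X \<in> carrier_mat n p" and w: "w \<in> carrier_vec p" "sup_norm w \<le> 1" and l: "l > 0" and p: "p > 0"
  shows "measure_pmf.prob (rademacher_vec n)
    {b. U_plus n (signal_set X) l < sup_norm (pinv X *\<^sub>v (diag b *\<^sub>v (X *\<^sub>v w)))} \<le> 2 / l\<^sup>2"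
proof -
  define B where "B = pinv X"
  have B: "B \<in> carrier_mat p n" unfolding B_def by (rule pinv_carrier[OF X])
  have el: "(diag (Matrix.row B j) * X) *\<^sub>v w = Matrix.vec n (\<lambda>i. B $$ (j, i) * (X *\<^sub>v w) $ i)"
    if w: "w \<in> carrier_vec p" and j: "j < p" for w j
  proof -
    have r: "Matrix.row B j \<in> carrier_vec n" using B j by simp
    have "(diag (Matrix.row B j) * X) *\<^sub>v w = diag (Matrix.row B j) *\<^sub>v (X *\<^sub>v w)"
      using assoc_mult_mat_vec[OF diag_carrier[OF r] X w] .
    then show ?thesis using B X w j r by (auto simp: diag_mult_vec[of _ n] intro!: eq_vecI)
  qed
  have S: "signal_set X = {Matrix.vec n (\<lambda>i. B $$ (j, i) * (X *\<^sub>v w) $ i) | w j.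
      w \<in> carrier_vec p \<and> sup_norm w \<le> 1 \<and> j < p}"
    unfolding signal_set_def B_def[symmetric] by (intro Collect_cong ex_cong1) (use X el in auto)
  \<comment> \<open>A crude witness of boundedness, from entrywise bounds on \<open>X w\<close> over
    the unit ball of the sup-norm.\<close>
  define R where "R = (\<Sum>j<p. \<Sum>i<n. \<bar>B $$ (j, i)\<bar> * (\<Sum>k<p. \<bar>X $$ (i, k)\<bar>))"
  have bdd: "eucl_norm t \<le> R" if t: "t \<in> signal_set X" for t
  proof -
    obtain w j where t: "t = Matrix.vec n (\<lambda>i. B $$ (j, i) * (X *\<^sub>v w) $ i)"
      and w: "w \<in> carrier_vec p" "sup_norm w \<le> 1" and j: "j < p" using t unfolding S by auto
    have "\<bar>(X *\<^sub>v w) $ i\<bar> \<le> (\<Sum>k<p. \<bar>X $$ (i, k)\<bar>)" if i: "i < n" for i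
    proof -
      have "\<bar>(X *\<^sub>v w) $ i\<bar> = \<bar>\<Sum>k<p. X $$ (i, k) * w $ k\<bar>"
        using X w i by (simp add: scalar_prod_def lessThan_atLeast0)
      also have "\<dots> \<le> (\<Sum>k<p. \<bar>X $$ (i, k)\<bar> * 1)"
      proof (intro sum_abs[THEN order_trans] sum_mono)
        fix k assume "k \<in> {..<p}"
        then have "\<bar>w $ k\<bar> \<le> 1" using w abs_index_le_sup_norm[of k w] by simp
        then show "\<bar>X $$ (i, k) * w $ k\<bar> \<le> \<bar>X $$ (i, k)\<bar> * 1"
          unfolding abs_mult by (intro mult_left_mono) auto
      qed
      finally show ?thesis by simp
    qed
    then have "(\<Sum>i<n. \<bar>t $ i\<bar>) \<le> (\<Sum>i<n. \<bar>B $$ (j, i)\<bar> * (\<Sum>k<p. \<bar>X $$ (i, k)\<bar>))"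
      unfolding t by (intro sum_mono) (auto simp: abs_mult intro!: mult_left_mono)
    also have "\<dots> \<le> R"
      unfolding R_def using j by (intro member_le_sum[of j "{..<p}"]) (auto intro!: sum_nonneg)
    finally show ?thesis using eucl_norm_le_sum_abs[of t] by (simp add: t)
  qed
  have zero: "0\<^sub>v p \<in> carrier_vec p" "sup_norm (0\<^sub>v p) \<le> 1" by (auto simp: sup_norm_le_iff)
  have "measure_pmf.prob (rademacher_vec n)
    {b. U_plus n (signal_set X) l < sup_norm (B *\<^sub>v (diag b *\<^sub>v (X *\<^sub>v w)))} \<le> 2 / l\<^sup>2"
  proof (rule prob_sup_norm_le[of "signal_set X"])
    show "signal_set X \<subseteq> carrier_vec n" unfolding S by auto
    show "signal_set X \<noteq> {}" unfolding S using zero p by blast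
    show "- t \<in> signal_set X" if t: "t \<in> signal_set X" for t
    proof -
      obtain w j where t: "t = Matrix.vec n (\<lambda>i. B $$ (j, i) * (X *\<^sub>v w) $ i)"
        and w: "w \<in> carrier_vec p" "sup_norm w \<le> 1" and j: "j < p" using t unfolding S by auto
      have "- t = Matrix.vec n (\<lambda>i. B $$ (j, i) * (X *\<^sub>v (- w)) $ i)"
        using X w by (intro eq_vecI) (auto simp: t)
      then show ?thesis unfolding S using w j by (force simp: sup_norm_uminus)
    qed
    show "eucl_norm t \<le> R" if "t \<in> signal_set X" for t using bdd[OF that] .
    show "\<exists>t\<in>signal_set X. (B *\<^sub>v (diag b *\<^sub>v (X *\<^sub>v w))) $ j = t \<bullet> b"
      if b: "b \<in> carrier_vec n" and j: "j < dim_vec (B *\<^sub>v (diag b *\<^sub>v (X *\<^sub>v w)))" for b j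
    proof -
      have jp: "j < p" using j B by simp
      have "(B *\<^sub>v (diag b *\<^sub>v (X *\<^sub>v w))) $ j = Matrix.vec n (\<lambda>i. B $$ (j, i) * (X *\<^sub>v w) $ i) \<bullet> b"
        using mult_mat_diag_index[OF B b _ jp, of "X *\<^sub>v w"] X w b
        by (simp add: scalar_prod_def lessThan_atLeast0 mult_ac)
      moreover have "Matrix.vec n (\<lambda>i. B $$ (j, i) * (X *\<^sub>v w) $ i) \<in> signal_set X"
        unfolding S using w jp by blast
      ultimately show ?thesis by blast
    qed
  qed (auto intro: l)
  then show ?thesis by (simp add: B_def)
qed

section \<open>The randomization test\<close>

text \<open>In a sorted list the entries below \<open>c\<close> form an initial segment.\<close>

lemma sorted_nth_less_iff:
  fixes xs :: "'a :: linorder list"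
  assumes "sorted xs" "i < length xs"
  shows "xs ! i < c \<longleftrightarrow> i < length (filter (\<lambda>x. x < c) xs)"
  using assms
proof (induction xs arbitrary: i)
  case (Cons x xs)
  show ?case
  proof (cases "x < c")
    case True
    then show ?thesis using Cons by (cases i) auto
  next
    case False
    then have "\<And>y. y \<in> set (x # xs) \<Longrightarrow> \<not> y < c" using Cons.prems by force
    moreover from this have "filter (\<lambda>x. x < c) (x # xs) = []" by (simp add: filter_empty_conv)
    ultimately show ?thesis using Cons.prems(2) nth_mem by (metis list.size(3) not_less_zero)
  qed
qed simp

text \<open>The observed value is not strictly below itself, so only the \<open>K\<close> randomized
  values are counted. This reduces the ranking to pairwise comparisons, which serve both
  measurability and the lower bound. For rank 0 both sides hold.\<close>

lemma rejects_iff: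
  assumes level: "1 / (real K + 1) \<le> \<alpha>"
  shows "rejects f \<alpha> K G y \<longleftrightarrow>
    nat \<lceil>(1 - \<alpha>) * (real K + 1)\<rceil> \<le> card {j \<in> {1..K}. f (G j *\<^sub>v y) < f y}"
proof -
  define k where "k = nat \<lceil>(1 - \<alpha>) * (real K + 1)\<rceil>"
  \<comment> \<open>The level condition says exactly that
    \<open>(1 - \<alpha>) * (K + 1) \<le> K\<close>: the rank can be reached by the randomized
    values alone.\<close>
  have "1 \<le> \<alpha> * (real K + 1)" using level by (simp add: divide_le_eq)
  then have kK: "k \<le> K" by (simp add: k_def ceiling_le_iff algebra_simps)
  let ?xs = "f y # map (\<lambda>k. f (G k *\<^sub>v y)) [1..<K+1]"
  have "length (filter (\<lambda>x. x < f y) (sort ?xs)) = length (filter (\<lambda>x. x < f y) ?xs)"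
    by (metis mset_filter mset_sort size_mset)
  also have "\<dots> = length (filter (\<lambda>j. f (G j *\<^sub>v y) < f y) [1..<K+1])"
    by (simp add: filter_map o_def del: upt_Suc)
  also have "\<dots> = card (set (filter (\<lambda>j. f (G j *\<^sub>v y) < f y) [1..<K+1]))"
    by (intro distinct_card[symmetric] distinct_filter distinct_upt)
  also have "set (filter (\<lambda>j. f (G j *\<^sub>v y) < f y) [1..<K+1]) = {j \<in> {1..K}. f (G j *\<^sub>v y) < f y}"
    by auto
  finally have len: "length (filter (\<lambda>x. x < f y) (sort ?xs)) = card {j \<in> {1..K}. f (G j *\<^sub>v y) < f y}" .
  show ?thesis
  proof (cases "k = 0")
    case True
    then show ?thesis by (simp add: rejects_def order_statistic_def flip: k_def)
  next
    case False
    have "rejects f \<alpha> K G y \<longleftrightarrow> sort ?xs ! (k - 1) < f y"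
      using False by (simp add: rejects_def order_statistic_def ordered_values_def flip: k_def)
    also have "\<dots> \<longleftrightarrow> k - 1 < length (filter (\<lambda>x. x < f y) (sort ?xs))"
      using kK by (intro sorted_nth_less_iff sorted_sort) (simp del: upt_Suc)
    also have "\<dots> \<longleftrightarrow> k \<le> card {j \<in> {1..K}. f (G j *\<^sub>v y) < f y}"
      unfolding len using False by linarith
    finally show ?thesis by (simp add: k_def)
  qed
qed

lemma rejects_if_all_less:
  assumes level: "1 / (real K + 1) \<le> \<alpha>" and less: "\<And>j. j \<in> {1..K} \<Longrightarrow> f (G j *\<^sub>v y) < f y"
  shows "rejects f \<alpha> K G y"
proof -
  have "1 \<le> \<alpha> * (real K + 1)" using level by (simp add: divide_le_eq)
  then have "nat \<lceil>(1 - \<alpha>) * (real K + 1)\<rceil> \<le> K" by (simp add: ceiling_le_iff algebra_simps)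
  moreover have "{j \<in> {1..K}. f (G j *\<^sub>v y) < f y} = {1..K}" using less by auto
  ultimately show ?thesis by (simp add: rejects_iff[OF level])
qed

section \<open>Measurability and sign symmetry of the noise\<close>

lemma borel_measurable_sup_norm_mult:
  fixes B :: "real mat" and v :: "'a \<Rightarrow> real vec"
  assumes B: "B \<in> carrier_mat p n" and v: "\<And>\<omega>. \<omega> \<in> space M \<Longrightarrow> v \<omega> \<in> carrier_vec n"
    and meas: "\<And>i. i < n \<Longrightarrow> (\<lambda>\<omega>. v \<omega> $ i) \<in> borel_measurable M"
  shows "(\<lambda>\<omega>. sup_norm (B *\<^sub>v v \<omega>)) \<in> borel_measurable M"
proof -
  \<comment> \<open>The extra index \<open>p\<close> carries the 0 inserted in
    \<open>sup_norm\<close>, so the maximum runs over a fixed nonempty index set.\<close>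
  define f where "f j \<omega> = (if j < p then \<bar>\<Sum>i<n. B $$ (j, i) * v \<omega> $ i\<bar> else 0)" for j \<omega>
  have "sup_norm (B *\<^sub>v v \<omega>) = Max ((\<lambda>j. f j \<omega>) ` {..p})" if "\<omega> \<in> space M" for \<omega>
  proof -
    have "(\<lambda>j. \<bar>(B *\<^sub>v v \<omega>) $ j\<bar>) ` {..<dim_vec (B *\<^sub>v v \<omega>)} = (\<lambda>j. f j \<omega>) ` {..<p}"
      using B v[OF that] by (intro image_cong) (auto simp: f_def scalar_prod_def lessThan_atLeast0)
    moreover have "(\<lambda>j. f j \<omega>) ` {..p} = insert (f p \<omega>) ((\<lambda>j. f j \<omega>) ` {..<p})"
      unfolding lessThan_Suc_atMost[symmetric] lessThan_Suc by simp
    moreover have "f p \<omega> = 0" by (simp add: f_def)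
    ultimately show ?thesis unfolding sup_norm_def by simp
  qed
  moreover have "(\<lambda>\<omega>. Max ((\<lambda>j. f j \<omega>) ` {..p})) \<in> borel_measurable M"
  proof (rule borel_measurable_Max)
    fix j assume "j \<in> {..p}"
    show "f j \<in> borel_measurable M"
      unfolding f_def by (cases "j < p") (auto intro!: borel_measurable_sum borel_measurable_abs borel_measurable_times meas)
  qed simp
  ultimately show ?thesis by (simp cong: measurable_cong)
qed

context prob_space
begin

text \<open>By independence the joint law of the entries is the product of the marginals, and by
  symmetry no marginal changes under multiplication by a sign. Events are pulled back to the product
  space of the entries, which carries the needed sigma-algebra.\<close>

lemma prob_sign_change:
  assumes Y: "\<And>\<omega>. \<omega> \<in> space M \<Longrightarrow> Y \<omega> \<in> carrier_vec n"
    and indep: "indep_vars (\<lambda>_. borel) (\<lambda>i \<omega>. Y \<omega> $ i) {..<n}"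
    and symmetric: "\<And>i. i < n \<Longrightarrow> distr M borel (\<lambda>\<omega>. Y \<omega> $ i) = distr M borel (\<lambda>\<omega>. - (Y \<omega> $ i))"
    and s: "s \<in> sign_vecs n"
    and Q: "Measurable.pred (\<Pi>\<^sub>M i\<in>{..<n}. borel) (\<lambda>x. Q (Matrix.vec n x))"
  shows "prob {\<omega> \<in> space M. Q (diag s *\<^sub>v Y \<omega>)} = prob {\<omega> \<in> space M. Q (Y \<omega>)}"
\<comment> \<open>The product characterization of independence used below asks for a nonempty index
  set.\<close>
proof (cases "n = 0")
  case True
  have "diag s *\<^sub>v Y \<omega> = Y \<omega>" if "\<omega> \<in> space M" for \<omega>
    using Y[OF that] s True by (intro eq_vecI) (auto simp: diag_def mat_diag_def sign_vecs_def)
  then show ?thesis by (metis (mono_tags, lifting) Collect_cong)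
next
  case False
  define I where "I = {..<n}"
  have I: "I \<noteq> {}" using False by (auto simp: I_def)
  have rv: "(\<lambda>\<omega>. Y \<omega> $ i) \<in> borel_measurable M" if "i \<in> I" for i
    using indep that by (auto simp: indep_vars_def I_def)
  have sv: "s $ i = 1 \<or> s $ i = -1" if "i \<in> I" for i using s that by (auto simp: sign_vecs_def I_def)
  have indep': "indep_vars (\<lambda>_. borel) (\<lambda>i \<omega>. s $ i * Y \<omega> $ i) I"
    using indep unfolding I_def[symmetric] by (rule indep_vars_compose2) simp
  have rv': "(\<lambda>\<omega>. s $ i * Y \<omega> $ i) \<in> borel_measurable M" if "i \<in> I" for i
    using rv[OF that] by simp
  have marginal: "distr M borel (\<lambda>\<omega>. s $ i * Y \<omega> $ i) = distr M borel (\<lambda>\<omega>. Y \<omega> $ i)" if "i \<in> I" for i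
    using sv[OF that] symmetric[of i] that by (auto simp: I_def)
  have "distr M (\<Pi>\<^sub>M i\<in>I. borel) (\<lambda>\<omega>. \<lambda>i\<in>I. s $ i * Y \<omega> $ i) = (\<Pi>\<^sub>M i\<in>I. distr M borel (\<lambda>\<omega>. s $ i * Y \<omega> $ i))"
    using indep' indep_vars_iff_distr_eq_PiM'[OF I, where M' = "\<lambda>_. borel" and X = "\<lambda>i \<omega>. s $ i * Y \<omega> $ i"] rv' by simp
  also have "\<dots> = (\<Pi>\<^sub>M i\<in>I. distr M borel (\<lambda>\<omega>. Y \<omega> $ i))"
    by (rule PiM_cong) (auto simp: marginal)
  also have "\<dots> = distr M (\<Pi>\<^sub>M i\<in>I. borel) (\<lambda>\<omega>. \<lambda>i\<in>I. Y \<omega> $ i)"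
    using indep indep_vars_iff_distr_eq_PiM'[OF I, where M' = "\<lambda>_. borel" and X = "\<lambda>i \<omega>. Y \<omega> $ i"] rv by (simp add: I_def)
  finally have law: "distr M (\<Pi>\<^sub>M i\<in>I. borel) (\<lambda>\<omega>. \<lambda>i\<in>I. s $ i * Y \<omega> $ i) = distr M (\<Pi>\<^sub>M i\<in>I. borel) (\<lambda>\<omega>. \<lambda>i\<in>I. Y \<omega> $ i)" .
  define E where "E = {x \<in> space (\<Pi>\<^sub>M i\<in>I. borel :: real measure). Q (Matrix.vec n x)}"
  have E: "E \<in> sets (\<Pi>\<^sub>M i\<in>I. borel)" using Q by (simp add: E_def I_def pred_def)
  have m: "(\<lambda>\<omega>. \<lambda>i\<in>I. Y \<omega> $ i) \<in> measurable M (\<Pi>\<^sub>M i\<in>I. borel)" "(\<lambda>\<omega>. \<lambda>i\<in>I. s $ i * Y \<omega> $ i) \<in> measurable M (\<Pi>\<^sub>M i\<in>I. borel)"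
    by (auto intro!: measurable_restrict rv rv')
  have v: "Matrix.vec n (\<lambda>i\<in>I. Y \<omega> $ i) = Y \<omega>" "Matrix.vec n (\<lambda>i\<in>I. s $ i * Y \<omega> $ i) = diag s *\<^sub>v Y \<omega>" if "\<omega> \<in> space M" for \<omega>
    using Y[OF that] s by (auto intro!: eq_vecI simp: I_def diag_mult_vec[of _ n] sign_vecs_def)
  have "prob {\<omega> \<in> space M. Q (diag s *\<^sub>v Y \<omega>)} = prob ((\<lambda>\<omega>. \<lambda>i\<in>I. s $ i * Y \<omega> $ i) -` E \<inter> space M)"
    by (rule arg_cong[where f = prob]) (auto simp: E_def v space_PiM)
  also have "\<dots> = prob ((\<lambda>\<omega>. \<lambda>i\<in>I. Y \<omega> $ i) -` E \<inter> space M)"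
    using measure_distr[OF m(1) E] measure_distr[OF m(2) E] law by simp
  also have "\<dots> = prob {\<omega> \<in> space M. Q (Y \<omega>)}"
    by (rule arg_cong[where f = prob]) (auto simp: E_def v space_PiM)
  finally show ?thesis .
qed

end

section \<open>The random group elements and the rejection event\<close>

lemma finite_sign_group: "finite (sign_group n)"
  unfolding sign_group_eq by (intro finite_imageI finite_sign_vecs)

lemma sign_group_nonempty: "sign_group n \<noteq> {}"
  unfolding sign_group_eq using sign_vecs_nonempty by auto

lemma prob_space_uniform_sign_group: "prob_space (uniform_count_measure (sign_group n))"
  by (intro prob_space_uniform_count_measure finite_sign_group sign_group_nonempty)

lemma prob_space_group_draws: "prob_space (group_draws n K)"
  unfolding group_draws_def by (intro prob_space_PiM prob_space_uniform_sign_group)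

lemma measure_uniform_sign_group:
  "measure (uniform_count_measure (sign_group n)) {g \<in> sign_group n. Q g} =
    measure_pmf.prob (rademacher_vec n) {b. Q (diag b)}"
proof -
  have inj: "inj_on diag (sign_vecs n)"
    by (rule inj_on_subset[OF inj_on_diag]) (auto simp: sign_vecs_def)
  have eq: "{g \<in> sign_group n. Q g} = diag ` (sign_vecs n \<inter> {b. Q (diag b)})"
    by (auto simp: sign_group_eq)
  have "card {g \<in> sign_group n. Q g} = card (sign_vecs n \<inter> {b. Q (diag b)})"
    unfolding eq by (intro card_image inj_on_subset[OF inj]) auto
  moreover have "card (sign_group n) = card (sign_vecs n)"
    unfolding sign_group_eq by (rule card_image[OF inj])
  ultimately show ?thesis
    unfolding rademacher_vec_eq_pmf_of_set
    by (subst measure_uniform_count_measure[OF finite_sign_group])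
       (auto simp: measure_pmf_of_set sign_vecs_nonempty finite_sign_vecs)
qed

lemma space_group_draws: "space (group_draws n K) = (\<Pi>\<^sub>E k\<in>{1..K}. sign_group n)"
  by (simp add: group_draws_def space_PiM space_uniform_count_measure)

lemma finite_space_group_draws: "finite (space (group_draws n K))"
  unfolding space_group_draws by (intro finite_PiE finite_sign_group) auto

text \<open>Singletons are products of measurable singletons and the space is finite, so every event
  about the draws is measurable.\<close>

lemma sets_group_draws: "sets (group_draws n K) = Pow (space (group_draws n K))"
proof
  show "sets (group_draws n K) \<subseteq> Pow (space (group_draws n K))"
    by (rule sets.space_closed)
  have "{G} \<in> sets (group_draws n K)" if G: "G \<in> space (group_draws n K)" for G
  proof -
    have "(\<Pi>\<^sub>E k\<in>{1..K}. {G k}) \<in> sets (group_draws n K)"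
      unfolding group_draws_def using G
      by (intro sets_PiM_I_finite) (auto simp: space_group_draws sets_uniform_count_measure)
    moreover have "(\<Pi>\<^sub>E k\<in>{1..K}. {G k}) = {G}"
      using G by (intro PiE_singleton) (auto simp: space_group_draws PiE_def)
    ultimately show ?thesis by simp
  qed
  then have "(\<Union>G\<in>A. {G}) \<in> sets (group_draws n K)" if "A \<subseteq> space (group_draws n K)" for A
    using that by (intro sets.finite_UN finite_subset[OF that finite_space_group_draws]) auto
  then show "Pow (space (group_draws n K)) \<subseteq> sets (group_draws n K)" by auto
qed

text \<open>Each draw is uniform on the group, and \<open>diag\<close> is a bijection from sign
  vectors onto it; this carries the Rademacher bounds over to the draws.\<close>

lemma measure_group_draws_component:
  assumes "k \<in> {1..K}"
  shows "measure (group_draws n K) {G \<in> space (group_draws n K). Q (G k)} =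
    measure_pmf.prob (rademacher_vec n) {b. Q (diag b)}"
proof -
  have "uniform_count_measure (sign_group n) =
      distr (group_draws n K) (uniform_count_measure (sign_group n)) (\<lambda>G. G k)"
    unfolding group_draws_def using assms
    by (intro distr_PiM_component[symmetric] prob_space_uniform_sign_group)
  then have "measure (uniform_count_measure (sign_group n)) {g \<in> sign_group n. Q g} =
      measure (distr (group_draws n K) (uniform_count_measure (sign_group n)) (\<lambda>G. G k)) {g \<in> sign_group n. Q g}"
    by simp
  also have "\<dots> = measure (group_draws n K) ((\<lambda>G. G k) -` {g \<in> sign_group n. Q g} \<inter> space (group_draws n K))"
    using assms by (intro measure_distr) (auto simp: group_draws_def sets_uniform_count_measure)
  also have "(\<lambda>G. G k) -` {g \<in> sign_group n. Q g} \<inter> space (group_draws n K) = {G \<in> space (group_draws n K). Q (G k)}"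
    using assms by (auto simp: space_group_draws)
  finally show ?thesis unfolding measure_uniform_sign_group ..
qed

text \<open>The draws take finitely many values, so the event is a finite union of slices. Within a
  slice the count of smaller values is expressed by a set \<open>J\<close> of at least
  \<open>k\<close> indices, that is, by finitely many comparisons of measurable statistics.\<close>

lemma rejection_event_measurable:
  fixes X :: "real mat" and Y :: "'a \<Rightarrow> real vec"
  assumes level: "1 / (real K + 1) \<le> \<alpha>"
    and X: "X \<in> carrier_mat n p"
    and Y: "\<And>\<omega>. \<omega> \<in> space M \<Longrightarrow> Y \<omega> \<in> carrier_vec n"
    and meas: "\<And>i. i < n \<Longrightarrow> (\<lambda>\<omega>. Y \<omega> $ i) \<in> borel_measurable M"
  shows "{(\<omega>, G) \<in> space (M \<Otimes>\<^sub>M group_draws n K). rejects (test_stat X) \<alpha> K G (Y \<omega>)}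
    \<in> sets (M \<Otimes>\<^sub>M group_draws n K)"
proof -
  define S where "S = space (group_draws n K)"
  have B: "pinv X \<in> carrier_mat p n" by (rule pinv_carrier[OF X])
  have m0: "(\<lambda>\<omega>. test_stat X (Y \<omega>)) \<in> borel_measurable M"
    unfolding test_stat_def by (rule borel_measurable_sup_norm_mult[OF B Y meas])
  have m1: "(\<lambda>\<omega>. test_stat X (g *\<^sub>v Y \<omega>)) \<in> borel_measurable M" if g: "g \<in> sign_group n" for g
  proof -
    obtain s where s: "s \<in> carrier_vec n" "g = diag s" using g by (auto simp: sign_group_def)
    have Bg: "pinv X * g \<in> carrier_mat p n" using B s diag_carrier[of s n] by simp
    have "(\<lambda>\<omega>. sup_norm (pinv X * g *\<^sub>v Y \<omega>)) \<in> borel_measurable M"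
      by (rule borel_measurable_sup_norm_mult[OF Bg Y meas])
    moreover have "test_stat X (g *\<^sub>v Y \<omega>) = sup_norm (pinv X * g *\<^sub>v Y \<omega>)" if "\<omega> \<in> space M" for \<omega>
      using assoc_mult_mat_vec[OF B diag_carrier[OF s(1)] Y[OF that]] s by (simp add: test_stat_def)
    ultimately show ?thesis by (simp cong: measurable_cong)
  qed
  define k where "k = nat \<lceil>(1 - \<alpha>) * (real K + 1)\<rceil>"
  have slice: "{\<omega> \<in> space M. rejects (test_stat X) \<alpha> K G (Y \<omega>)} \<in> sets M" if G: "G \<in> S" for G
  proof -
    have "rejects (test_stat X) \<alpha> K G (Y \<omega>) \<longleftrightarrow>
        (\<exists>J\<in>{J. J \<subseteq> {1..K} \<and> k \<le> card J}. \<forall>j\<in>J. test_stat X (G j *\<^sub>v Y \<omega>) < test_stat X (Y \<omega>))"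
      (is "?L \<longleftrightarrow> ?R") for \<omega>
    proof
      assume ?L
      then show ?R unfolding rejects_iff[OF level] k_def
        by (intro bexI[of _ "{j \<in> {1..K}. test_stat X (G j *\<^sub>v Y \<omega>) < test_stat X (Y \<omega>)}"]) auto
    next
      assume ?R
      then obtain J where J: "J \<subseteq> {1..K}" "k \<le> card J" "\<forall>j\<in>J. test_stat X (G j *\<^sub>v Y \<omega>) < test_stat X (Y \<omega>)" by auto
      have "card J \<le> card {j \<in> {1..K}. test_stat X (G j *\<^sub>v Y \<omega>) < test_stat X (Y \<omega>)}"
        using J by (intro card_mono) auto
      then show ?L unfolding rejects_iff[OF level] using J(2) by (simp add: k_def)
    qed
    moreover have "{\<omega> \<in> space M. \<exists>J\<in>{J. J \<subseteq> {1..K} \<and> k \<le> card J}. \<forall>j\<in>J. test_stat X (G j *\<^sub>v Y \<omega>) < test_stat X (Y \<omega>)} \<in> sets M"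
    proof (intro sets.sets_Collect_finite_Ex sets.sets_Collect_finite_All)
      fix J j assume J: "J \<in> {J. J \<subseteq> {1..K} \<and> k \<le> card J}" and j: "j \<in> J"
      then have "G j \<in> sign_group n" using G by (auto simp: S_def space_group_draws PiE_def)
      then show "{\<omega> \<in> space M. test_stat X (G j *\<^sub>v Y \<omega>) < test_stat X (Y \<omega>)} \<in> sets M"
        using m0 m1 by (intro borel_measurable_less) auto
    qed (auto intro: finite_subset)
    ultimately show ?thesis by simp
  qed
  have "{(\<omega>, G) \<in> space (M \<Otimes>\<^sub>M group_draws n K). rejects (test_stat X) \<alpha> K G (Y \<omega>)}
     = (\<Union>G\<in>S. {\<omega> \<in> space M. rejects (test_stat X) \<alpha> K G (Y \<omega>)} \<times> {G})"
    by (auto simp: space_pair_measure S_def)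
  also have "\<dots> \<in> sets (M \<Otimes>\<^sub>M group_draws n K)"
    using slice finite_space_group_draws[of n K]
    by (intro sets.finite_UN pair_measureI) (auto simp: S_def sets_group_draws)
  finally show ?thesis .
qed

text \<open>The deterministic step. Since \<open>X\<close> sees \<beta> only through its projection,
  \<open>X \<beta> = s X w\<close> with \<open>w\<close> normalized, so the signal bound for the
  unit ball applies and scales with \<open>s\<close>. The hypothesis \<open>gap\<close> is
  \<open>s - t > s * U + t\<close>.\<close>

lemma test_stat_less_test_stat:
  fixes X :: "real mat"
  assumes X: "X \<in> carrier_mat n p" and \<beta>: "\<beta> \<in> carrier_vec p" and e: "e \<in> carrier_vec n"
    and g: "g \<in> carrier_mat n n"
    and s: "s = sup_norm (proj_row_space X \<beta>)" "s > 0" and w: "w = (1 / s) \<cdot>\<^sub>v proj_row_space X \<beta>"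
    and noise: "sup_norm (pinv X *\<^sub>v e) \<le> t" "sup_norm (pinv X *\<^sub>v (g *\<^sub>v e)) \<le> t"
    and signal: "sup_norm (pinv X *\<^sub>v (g *\<^sub>v (X *\<^sub>v w))) \<le> U"
    and gap: "2 * t < s * (1 - U)"
  shows "test_stat X (g *\<^sub>v (X *\<^sub>v \<beta> + e)) < test_stat X (X *\<^sub>v \<beta> + e)"
proof -
  define B where "B = pinv X"
  have B: "B \<in> carrier_mat p n" unfolding B_def by (rule pinv_carrier[OF X])
  define u where "u = proj_row_space X \<beta>"
  have uB: "u = B *\<^sub>v (X *\<^sub>v \<beta>)" unfolding u_def B_def by (rule proj_row_space_eq[OF X \<beta>])
  have u: "u \<in> carrier_vec p" using uB X B \<beta> by simp
  have Xu: "X *\<^sub>v u = X *\<^sub>v \<beta>" unfolding u_def by (rule mult_proj_row_space[OF X \<beta>])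
  have wc: "w \<in> carrier_vec p" using u by (simp add: w u_def)
  have "u = s \<cdot>\<^sub>v w" using s(2) u by (intro eq_vecI) (auto simp: w u_def)
  then have Xb: "X *\<^sub>v \<beta> = s \<cdot>\<^sub>v (X *\<^sub>v w)"
    using mult_mat_vec[OF X wc, of s] Xu by simp
  have "B *\<^sub>v (X *\<^sub>v \<beta> + e) + - (B *\<^sub>v e) = u"
    unfolding uB using B X \<beta> e by (intro eq_vecI) (auto simp: mult_add_distrib_mat_vec[of _ p n])
  then have "s \<le> test_stat X (X *\<^sub>v \<beta> + e) + sup_norm (B *\<^sub>v e)"
    using sup_norm_add_le[of "B *\<^sub>v (X *\<^sub>v \<beta> + e)" p "- (B *\<^sub>v e)"] B X \<beta> e
    by (simp add: s(1) sup_norm_uminus test_stat_def flip: u_def B_def)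
  moreover have "B *\<^sub>v (g *\<^sub>v (X *\<^sub>v \<beta> + e)) = s \<cdot>\<^sub>v (B *\<^sub>v (g *\<^sub>v (X *\<^sub>v w))) + B *\<^sub>v (g *\<^sub>v e)"
    using B X g wc e unfolding Xb
    by (simp add: mult_add_distrib_mat_vec[of _ p n] mult_add_distrib_mat_vec[of _ n n] mult_mat_vec[of _ p n] mult_mat_vec[of _ n n])
  then have "test_stat X (g *\<^sub>v (X *\<^sub>v \<beta> + e)) \<le> sup_norm (s \<cdot>\<^sub>v (B *\<^sub>v (g *\<^sub>v (X *\<^sub>v w)))) + sup_norm (B *\<^sub>v (g *\<^sub>v e))"
    using sup_norm_add_le[of "s \<cdot>\<^sub>v (B *\<^sub>v (g *\<^sub>v (X *\<^sub>v w)))" p "B *\<^sub>v (g *\<^sub>v e)"] B g e X wc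
    by (simp add: test_stat_def mult_mat_vec_carrier[of _ p n] mult_mat_vec_carrier[of _ n n]
        mult_mat_vec_carrier[of _ n p] flip: B_def)
  moreover have "sup_norm (s \<cdot>\<^sub>v (B *\<^sub>v (g *\<^sub>v (X *\<^sub>v w)))) \<le> s * U"
    using sup_norm_smult_le[of s "B *\<^sub>v (g *\<^sub>v (X *\<^sub>v w))"] signal s(2)
    by (smt (verit) B_def mult_left_mono)
  ultimately show ?thesis using noise gap by (simp add: B_def right_diff_distrib)
qed

section \<open>Lower bound on the rejection probability\<close>

context prob_space
begin

text \<open>The constants count bad events: \<open>K + 1\<close> noise terms, observed and
  randomized, each large with probability at most \<open>1 - prob good + 2 / l^2\<close>, and
  \<open>K\<close> signal terms, each large with probability at most \<open>2 / l^2\<close>.\<close>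

lemma rejection_prob_ge:
  fixes X :: "real mat" and \<epsilon> :: "'a \<Rightarrow> real vec"
  assumes level: "1 / (real K + 1) \<le> \<alpha>"
    and X: "X \<in> carrier_mat n p" and \<beta>: "\<beta> \<in> carrier_vec p"
    and \<epsilon>: "\<And>\<omega>. \<omega> \<in> space M \<Longrightarrow> \<epsilon> \<omega> \<in> carrier_vec n"
    and indep: "indep_vars (\<lambda>_. borel) (\<lambda>i \<omega>. \<epsilon> \<omega> $ i) {..<n}"
    and symmetric: "\<And>i. i < n \<Longrightarrow> distr M borel (\<lambda>\<omega>. \<epsilon> \<omega> $ i) = distr M borel (\<lambda>\<omega>. - (\<epsilon> \<omega> $ i))"
    and l: "l > 0" and t: "t > 0"
    and good: "good = {\<omega> \<in> space M. U_plus n (set (rows (noise_mat X (map_vec abs (\<epsilon> \<omega>))))) l \<le> t}"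
      "good \<in> events"
    and signal: "sup_norm (proj_row_space X \<beta>) * ((1 - U_plus n (signal_set X) l) / (2 * t)) > 1"
  shows "rejection_prob M X \<alpha> K (\<lambda>\<omega>. X *\<^sub>v \<beta> + \<epsilon> \<omega>) \<ge>
    1 - ((real K + 1) * (1 - prob good + 2 / l\<^sup>2) + real K * (2 / l\<^sup>2))"
proof -
  define B where "B = pinv X"
  have B: "B \<in> carrier_mat p n" unfolding B_def by (rule pinv_carrier[OF X])
  define U where "U = U_plus n (signal_set X) l"
  define s where "s = sup_norm (proj_row_space X \<beta>)"
  define w where "w = (1 / s) \<cdot>\<^sub>v proj_row_space X \<beta>"
  define \<delta> where "\<delta> = 2 / l\<^sup>2"
  define N where "N = group_draws n K"
  define Y where "Y \<omega> = X *\<^sub>v \<beta> + \<epsilon> \<omega>" for \<omega>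
  interpret N: prob_space N unfolding N_def by (rule prob_space_group_draws)
  interpret MN: pair_prob_space M N ..
  have \<delta>: "0 \<le> \<delta>" by (simp add: \<delta>_def)
  have gap: "2 * t < s * (1 - U)"
    using signal t by (simp add: s_def U_def field_simps)
  have "s \<noteq> 0" using gap t by auto
  then have s: "s > 0" using sup_norm_nonneg[of "proj_row_space X \<beta>"] by (simp add: s_def)
  have u: "proj_row_space X \<beta> \<in> carrier_vec p"
    using proj_row_space_eq[OF X \<beta>] pinv_carrier[OF X] X \<beta> by simp
  \<comment> \<open>In dimension 0 the sup-norm vanishes. Positivity of \<open>p\<close> makes
    \<open>signal_set X\<close> nonempty in \<open>prob_signal_le\<close>.\<close>
  then have p: "p > 0" using s by (intro gr0I) (simp add: s_def sup_norm_def)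
  have w: "w \<in> carrier_vec p" "sup_norm w \<le> 1"
    using u s sup_norm_smult_le[of "1 / s" "proj_row_space X \<beta>"] by (auto simp: w_def s_def)
  have meas: "(\<lambda>\<omega>. \<epsilon> \<omega> $ i) \<in> borel_measurable M" if "i < n" for i
    using indep that by (auto simp: indep_vars_def)
  have Yc: "Y \<omega> \<in> carrier_vec n" if "\<omega> \<in> space M" for \<omega> using \<epsilon>[OF that] X \<beta> by (simp add: Y_def)
  have Ymeas: "(\<lambda>\<omega>. Y \<omega> $ i) \<in> borel_measurable M" if "i < n" for i
  proof -
    have "(\<lambda>\<omega>. (X *\<^sub>v \<beta>) $ i + \<epsilon> \<omega> $ i) \<in> borel_measurable M" using meas[OF that] by simp
    moreover have "Y \<omega> $ i = (X *\<^sub>v \<beta>) $ i + \<epsilon> \<omega> $ i" if "\<omega> \<in> space M" for \<omega>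
      using \<epsilon>[OF that] \<open>i < n\<close> by (simp add: Y_def)
    ultimately show ?thesis by (simp cong: measurable_cong)
  qed

  define A where "A = {\<omega> \<in> space M. t < sup_norm (B *\<^sub>v \<epsilon> \<omega>)}"
  have m\<epsilon>: "(\<lambda>\<omega>. sup_norm (C *\<^sub>v \<epsilon> \<omega>)) \<in> borel_measurable M" if "C \<in> carrier_mat p n" for C
    by (rule borel_measurable_sup_norm_mult[OF that \<epsilon> meas])
  have A: "A \<in> events" unfolding A_def using m\<epsilon>[OF B] by measurable
  \<comment> \<open>The chance, given the data, that one randomized noise term exceeds
    \<open>t\<close>. Each \<open>As b\<close> has the probability of \<open>A\<close>, so the mean
    of \<open>h\<close> is \<open>prob A\<close>: bounding \<open>h\<close> bounds the observed
    noise as well.\<close>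
  define h where "h \<omega> = measure_pmf.prob (rademacher_vec n) {b. t < sup_norm (B *\<^sub>v (diag b *\<^sub>v \<epsilon> \<omega>))}" for \<omega>
  define As where "As b = {\<omega> \<in> space M. t < sup_norm (B *\<^sub>v (diag b *\<^sub>v \<epsilon> \<omega>))}" for b
  have As: "As b \<in> events" if b: "b \<in> sign_vecs n" for b
  proof -
    have bc: "b \<in> carrier_vec n" using b by (simp add: sign_vecs_def)
    have "As b = {\<omega> \<in> space M. t < sup_norm (B * diag b *\<^sub>v \<epsilon> \<omega>)}"
      unfolding As_def using assoc_mult_mat_vec[OF B diag_carrier[OF bc] \<epsilon>] by auto
    moreover have "B * diag b \<in> carrier_mat p n" using B diag_carrier[OF bc] by simp
    note m\<epsilon>[OF this]
    then have "{\<omega> \<in> space M. t < sup_norm (B * diag b *\<^sub>v \<epsilon> \<omega>)} \<in> events" by measurable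
    ultimately show ?thesis by simp
  qed
  have probAs: "prob (As b) = prob A" if b: "b \<in> sign_vecs n" for b
    unfolding As_def A_def
  proof (rule prob_sign_change[OF \<epsilon> indep symmetric b])
    show "Measurable.pred (\<Pi>\<^sub>M i\<in>{..<n}. borel) (\<lambda>x. t < sup_norm (B *\<^sub>v Matrix.vec n x))"
      unfolding pred_def
      by (intro borel_measurable_less borel_measurable_const borel_measurable_sup_norm_mult[OF B]) auto
  qed
  \<comment> \<open>As a finite average of indicators, \<open>h\<close> is integrable and its mean
    needs no Fubini argument.\<close>
  have h_eq: "h \<omega> = (\<Sum>b\<in>sign_vecs n. indicator (As b) \<omega>) / card (sign_vecs n)" if "\<omega> \<in> space M" for \<omega>
    unfolding h_def rademacher_vec_eq_pmf_of_set using that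
    by (simp add: measure_pmf_of_set finite_sign_vecs sign_vecs_nonempty As_def indicator_def sum.If_cases Int_def)
  have int_avg: "integrable M (\<lambda>\<omega>. (\<Sum>b\<in>sign_vecs n. indicator (As b) \<omega>) / card (sign_vecs n) :: real)"
    using As by (auto intro!: integrable_real_indicator simp: emeasure_eq_measure)
  have int_h: "integrable M h"
    using int_avg h_eq by (simp cong: Bochner_Integration.integrable_cong)
  have "expectation h = (\<Sum>b\<in>sign_vecs n. prob (As b)) / card (sign_vecs n)"
  proof -
    have "expectation h = expectation (\<lambda>\<omega>. (\<Sum>b\<in>sign_vecs n. indicator (As b) \<omega>) / card (sign_vecs n))"
      by (rule Bochner_Integration.integral_cong) (simp_all add: h_eq)
    also have "\<dots> = (\<Sum>b\<in>sign_vecs n. expectation (indicator (As b))) / card (sign_vecs n)"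
      using As by (subst integral_divide_zero, subst Bochner_Integration.integral_sum)
        (auto intro!: integrable_real_indicator simp: emeasure_eq_measure)
    finally show ?thesis using As by simp
  qed
  then have Eh: "expectation h = prob A"
    using finite_sign_vecs[of n] sign_vecs_nonempty[of n] by (simp add: probAs)
  have h_le: "h \<omega> \<le> indicator (space M - good) \<omega> + \<delta>" if \<omega>: "\<omega> \<in> space M" for \<omega>
  proof (cases "\<omega> \<in> good")
    case True
    then have "h \<omega> \<le> \<delta>"
      unfolding h_def B_def \<delta>_def using good(1) by (intro prob_noise_le[OF X \<epsilon>[OF \<omega>] l t]) simp
    then show ?thesis by (simp add: indicator_def)
  next
    case False
    have "h \<omega> \<le> 1" unfolding h_def by (rule measure_pmf.prob_le_1)
    then show ?thesis using False \<omega> \<delta> by (simp add: indicator_def)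
  qed
  have "prob A \<le> expectation (\<lambda>\<omega>. indicator (space M - good) \<omega> + \<delta>)"
    unfolding Eh[symmetric] using h_le good(2)
    by (intro integral_mono int_h) (auto intro!: integrable_real_indicator simp: emeasure_eq_measure)
  also have "\<dots> = prob (space M - good) + \<delta>"
    using good(2) by (subst Bochner_Integration.integral_add)
      (auto intro!: integrable_real_indicator simp: emeasure_eq_measure prob_space)
  finally have probA: "prob A \<le> 1 - prob good + \<delta>"
    using prob_compl[OF good(2)] by simp

  define R where "R = {(\<omega>, G) \<in> space (M \<Otimes>\<^sub>M N). rejects (test_stat X) \<alpha> K G (Y \<omega>)}"
  have R: "R \<in> sets (M \<Otimes>\<^sub>M N)"
    unfolding R_def N_def by (rule rejection_event_measurable[OF level X Yc Ymeas])
  define C where "C = space (M \<Otimes>\<^sub>M N) - R"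
  have C: "C \<in> sets (M \<Otimes>\<^sub>M N)" using R by (simp add: C_def)
  \<comment> \<open>A bound for the chance of acceptance given \<omega>: at least 1 if the observed
    noise is too large, otherwise a union bound over the \<open>K\<close> draws.\<close>
  define b where "b \<omega> = indicator A \<omega> + real K * (h \<omega> + \<delta>)" for \<omega>
  have h0: "0 \<le> h \<omega>" for \<omega> by (simp add: h_def)
  have slice: "N.prob (Pair \<omega> -` C) \<le> b \<omega>" if \<omega>: "\<omega> \<in> space M" for \<omega>
  proof (cases "\<omega> \<in> A")
    case True
    then have "1 \<le> b \<omega>" using h0[of \<omega>] \<delta> by (simp add: b_def)
    then show ?thesis using N.prob_le_1 order_trans by blast
  next
    case False
    then have noise: "sup_norm (pinv X *\<^sub>v \<epsilon> \<omega>) \<le> t" using \<omega> by (simp add: A_def B_def)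
    define E1 where "E1 k = {G \<in> space N. t < sup_norm (B *\<^sub>v (G k *\<^sub>v \<epsilon> \<omega>))}" for k
    define E2 where "E2 k = {G \<in> space N. U < sup_norm (B *\<^sub>v (G k *\<^sub>v (X *\<^sub>v w)))}" for k
    have sets: "E1 k \<in> sets N" "E2 k \<in> sets N" for k
      by (auto simp: N_def sets_group_draws E1_def E2_def)
    have "Pair \<omega> -` C \<subseteq> (\<Union>k\<in>{1..K}. E1 k \<union> E2 k)"
    proof (rule ccontr)
      assume "\<not> ?thesis"
      then obtain G where "G \<in> Pair \<omega> -` C" "G \<notin> (\<Union>k\<in>{1..K}. E1 k \<union> E2 k)" by blast
      then have G: "(\<omega>, G) \<in> C" "\<And>k. k \<in> {1..K} \<Longrightarrow> G \<notin> E1 k \<and> G \<notin> E2 k" by auto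
      have GN: "G \<in> space N" using G(1) by (simp add: C_def space_pair_measure)
      have "rejects (test_stat X) \<alpha> K G (Y \<omega>)"
      proof (rule rejects_if_all_less[OF level])
        fix k assume k: "k \<in> {1..K}"
        then have "G k \<in> sign_group n" using GN by (auto simp: N_def space_group_draws)
        then have g: "G k \<in> carrier_mat n n" by (auto simp: sign_group_def intro: diag_carrier)
        show "test_stat X (G k *\<^sub>v Y \<omega>) < test_stat X (Y \<omega>)"
          unfolding Y_def
        proof (rule test_stat_less_test_stat[OF X \<beta> \<epsilon>[OF \<omega>] g s_def s w_def noise _ _ gap])
          show "sup_norm (pinv X *\<^sub>v (G k *\<^sub>v \<epsilon> \<omega>)) \<le> t" "sup_norm (pinv X *\<^sub>v (G k *\<^sub>v (X *\<^sub>v w))) \<le> U"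
            using G(2)[OF k] GN by (auto simp: E1_def E2_def B_def)
        qed
      qed
      moreover have "(\<omega>, G) \<in> space (M \<Otimes>\<^sub>M N)" "(\<omega>, G) \<notin> R" using G(1) by (auto simp: C_def)
      ultimately show False by (simp add: R_def)
    qed
    then have "N.prob (Pair \<omega> -` C) \<le> N.prob (\<Union>k\<in>{1..K}. E1 k \<union> E2 k)"
      using sets by (intro N.finite_measure_mono) auto
    also have "\<dots> \<le> (\<Sum>k\<in>{1..K}. N.prob (E1 k \<union> E2 k))"
      using sets by (intro N.finite_measure_subadditive_finite) auto
    also have "\<dots> \<le> (\<Sum>k\<in>{1..K}. h \<omega> + \<delta>)"
    proof (rule sum_mono)
      fix k assume k: "k \<in> {1..K}"
      have "N.prob (E1 k \<union> E2 k) \<le> N.prob (E1 k) + N.prob (E2 k)"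
        using sets by (intro measure_Un_le)
      moreover have "N.prob (E1 k) = h \<omega>"
        unfolding E1_def N_def h_def by (rule measure_group_draws_component[OF k])
      moreover have "N.prob (E2 k) \<le> \<delta>"
        unfolding E2_def N_def \<delta>_def U_def B_def using prob_signal_le[OF X w l p]
        by (subst measure_group_draws_component[OF k])
      ultimately show "N.prob (E1 k \<union> E2 k) \<le> h \<omega> + \<delta>" by linarith
    qed
    also have "\<dots> \<le> b \<omega>" by (simp add: b_def)
    finally show ?thesis .
  qed
  have int_b: "integrable M b"
    unfolding b_def using A int_h by (auto intro!: integrable_real_indicator simp: emeasure_eq_measure)
  have "expectation b = prob A + real K * (prob A + \<delta>)"
    unfolding b_def using A int_h
    by (subst Bochner_Integration.integral_add)
       (auto intro!: integrable_real_indicator simp: emeasure_eq_measure Eh prob_space)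
  have b0: "0 \<le> b \<omega>" for \<omega> using h0[of \<omega>] \<delta> by (simp add: b_def)
  \<comment> \<open>Integrating the bound for the slices over the data turns it into one for the
    product measure.\<close>
  have "emeasure (M \<Otimes>\<^sub>M N) C = (\<integral>\<^sup>+\<omega>. emeasure N (Pair \<omega> -` C) \<partial>M)"
    by (rule N.emeasure_pair_measure_alt[OF C])
  also have "\<dots> \<le> (\<integral>\<^sup>+\<omega>. ennreal (b \<omega>) \<partial>M)"
    using slice by (intro nn_integral_mono) (simp add: N.emeasure_eq_measure ennreal_leI)
  also have "\<dots> = ennreal (expectation b)"
    using int_b b0 by (intro nn_integral_eq_integral) auto
  finally have "measure (M \<Otimes>\<^sub>M N) C \<le> expectation b"
    using b0 by (simp add: MN.emeasure_eq_measure)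
  also have "expectation b = prob A + real K * (prob A + \<delta>)" by fact
  also have "\<dots> = (real K + 1) * prob A + real K * \<delta>" by (simp add: algebra_simps)
  also have "\<dots> \<le> (real K + 1) * (1 - prob good + \<delta>) + real K * \<delta>"
    using probA by (intro add_right_mono mult_left_mono) auto
  finally have "measure (M \<Otimes>\<^sub>M N) C \<le> (real K + 1) * (1 - prob good + \<delta>) + real K * \<delta>" .
  moreover have "measure (M \<Otimes>\<^sub>M N) C = 1 - measure (M \<Otimes>\<^sub>M N) R"
    unfolding C_def by (rule MN.prob_compl[OF R])
  moreover have "rejection_prob M X \<alpha> K (\<lambda>\<omega>. X *\<^sub>v \<beta> + \<epsilon> \<omega>) = measure (M \<Otimes>\<^sub>M N) R"
    using X by (simp add: rejection_prob_def R_def N_def Y_def)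
  ultimately show ?thesis by (simp add: \<delta>_def)
qed

lemma rejection_prob_le_1: "rejection_prob M X \<alpha> K Y \<le> 1"
proof -
  interpret N: prob_space "group_draws (dim_row X) K" by (rule prob_space_group_draws)
  interpret MN: pair_prob_space M "group_draws (dim_row X) K" ..
  show ?thesis unfolding rejection_prob_def by (rule MN.prob_le_1)
qed

end

section \<open>Consistency in the limit\<close>

theorem proposition3p6:
  fixes n p :: "nat \<Rightarrow> nat"
    and X :: "nat \<Rightarrow> real mat"
    and M :: "nat \<Rightarrow> 'a measure"
    and \<epsilon> :: "nat \<Rightarrow> 'a \<Rightarrow> real vec"
    and \<Theta> :: "nat \<Rightarrow> real vec set"
    and l t :: "nat \<Rightarrow> real"
    and \<alpha> :: real and K :: nat
  assumes level: "0 < \<alpha>" "\<alpha> \<le> 1" "K \<ge> 1" "1 / (real K + 1) \<le> \<alpha>"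
    and X: "\<And>m. m \<ge> 1 \<Longrightarrow> X m \<in> carrier_mat (n m) (p m)"
    and \<Theta>: "\<And>m. m \<ge> 1 \<Longrightarrow> \<Theta> m \<subseteq> carrier_vec (p m)"
    and prob: "\<And>m. m \<ge> 1 \<Longrightarrow> prob_space (M m)"
    and noise: "\<And>m \<omega>. m \<ge> 1 \<Longrightarrow> \<omega> \<in> space (M m) \<Longrightarrow> \<epsilon> m \<omega> \<in> carrier_vec (n m)"
    and indep: "\<And>m. m \<ge> 1 \<Longrightarrow>
      prob_space.indep_vars (M m) (\<lambda>_. borel) (\<lambda>i \<omega>. vec_index (\<epsilon> m \<omega>) i) {..<n m}"
    and symmetric: "\<And>m i. m \<ge> 1 \<Longrightarrow> i < n m \<Longrightarrow>
      distr (M m) borel (\<lambda>\<omega>. vec_index (\<epsilon> m \<omega>) i) = distr (M m) borel (\<lambda>\<omega>. - vec_index (\<epsilon> m \<omega>) i)"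
    and l: "\<And>m. m \<ge> 1 \<Longrightarrow> l m > 0" "filterlim l at_top sequentially"
    and t: "\<And>m. m \<ge> 1 \<Longrightarrow> t m > 0"
      "(\<lambda>m. measure (M m) {\<omega> \<in> space (M m).
          U_plus (n m) (set (rows (noise_mat (X m) (map_vec abs (\<epsilon> m \<omega>))))) (l m) \<le> t m})
        \<longlonglongrightarrow> 1"
    and signal: "\<And>\<beta>. alternative_seq X \<Theta> \<beta> \<Longrightarrow>
      liminf (\<lambda>m. ereal (sup_norm (proj_row_space (X m) (\<beta> m)) *
        ((1 - U_plus (n m) (signal_set (X m)) (l m)) / (2 * t m)))) > 1"
  shows "consistent_tests M \<epsilon> X \<Theta> \<alpha> K"
  unfolding consistent_tests_def
proof (intro allI impI)
  fix \<beta> assume alt: "alternative_seq X \<Theta> \<beta>"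
  define good where "good m = {\<omega> \<in> space (M m).
    U_plus (n m) (set (rows (noise_mat (X m) (map_vec abs (\<epsilon> m \<omega>))))) (l m) \<le> t m}" for m
  have lim: "(\<lambda>m. measure (M m) (good m)) \<longlonglongrightarrow> 1" using t(2) by (simp add: good_def)
  \<comment> \<open>A non-measurable set has measure 0 by convention, so the limit forces measurability.\<close>
  have "\<forall>\<^sub>F m in sequentially. measure (M m) (good m) > 0"
    using lim by (rule order_tendstoD) simp
  then have events: "\<forall>\<^sub>F m in sequentially. good m \<in> sets (M m)"
    by eventually_elim (metis measure_notin_sets less_irrefl)
  have "\<forall>\<^sub>F m in sequentially. 1 < ereal (sup_norm (proj_row_space (X m) (\<beta> m)) *
      ((1 - U_plus (n m) (signal_set (X m)) (l m)) / (2 * t m)))"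
    using signal[OF alt] by (rule less_LiminfD)
  then have sig: "\<forall>\<^sub>F m in sequentially. 1 < sup_norm (proj_row_space (X m) (\<beta> m)) *
      ((1 - U_plus (n m) (signal_set (X m)) (l m)) / (2 * t m))"
    by (simp add: one_ereal_def)
  define bound where "bound m = 1 - ((real K + 1) * (1 - measure (M m) (good m) + 2 / (l m)\<^sup>2) + real K * (2 / (l m)\<^sup>2))" for m
  have inv: "(\<lambda>m. 2 / (l m)\<^sup>2) \<longlonglongrightarrow> 0"
    by (intro real_tendsto_divide_at_top[OF tendsto_const] filterlim_pow_at_top l(2)) simp
  have "bound \<longlonglongrightarrow> 1 - ((real K + 1) * (1 - 1 + 0) + real K * 0)"
    unfolding bound_def by (intro tendsto_intros lim inv)
  then have bound: "bound \<longlonglongrightarrow> 1" by simp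
  have lower: "\<forall>\<^sub>F m in sequentially. bound m \<le> rejection_prob (M m) (X m) \<alpha> K (\<lambda>\<omega>. X m *\<^sub>v \<beta> m + \<epsilon> m \<omega>)"
    \<comment> \<open>The hypotheses say nothing about index 0, so \<open>m \<ge> 1\<close> joins
      the eventual facts.\<close>
    using eventually_ge_at_top[of 1] events sig
  proof eventually_elim
    case (elim m)
    note m = elim(1)
    have "\<beta> m \<in> carrier_vec (p m)" using alt X[OF m] m by (auto simp: alternative_seq_def)
    from prob_space.rejection_prob_ge[OF prob[OF m] level(4) X[OF m] this noise[OF m] indep[OF m]
        symmetric[OF m] l(1)[OF m] t(1)[OF m] good_def elim(2,3)]
    show ?case unfolding bound_def .
  qed
  have upper: "\<forall>\<^sub>F m in sequentially. rejection_prob (M m) (X m) \<alpha> K (\<lambda>\<omega>. X m *\<^sub>v \<beta> m + \<epsilon> m \<omega>) \<le> 1"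
    using eventually_ge_at_top[of 1] by eventually_elim (intro prob_space.rejection_prob_le_1 prob)
  show "(\<lambda>m. rejection_prob (M m) (X m) \<alpha> K (\<lambda>\<omega>. X m *\<^sub>v \<beta> m + \<epsilon> m \<omega>)) \<longlonglongrightarrow> 1"
    by (rule tendsto_sandwich[OF lower upper bound tendsto_const])
qed

end
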